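(* Let $n$ be a size parameter, $\varepsilon>0$, $d = \mathcal{O}(\log n/\varepsilon^2)$ large enough, and let $m$ be such that $m$ is divisible by $d$ and $s = m/d$ is a power of two; let $k = \log_2 s$. Given input $x \in \mathbb{R}^m$ and assuming $\varepsilon \le \frac{1}{k}$, the procedure SingleSketch (described below) outputs $v \in \mathbb{R}^d$ such that $\|v\| = (1 \pm \mathcal{O}(k\varepsilon))\|x\|$ with high probability, in time $\mathcal{O}\!\left(\frac{m \log n}{\varepsilon}\right)$. Moreover, the map $x \mapsto v$ is linear.
   Context: $\|\cdot\|$ is the Euclidean ($\ell_2$) norm. A random map $\varphi:\mathbb{R}^d\times\mathbb{R}^d\to\mathbb{R}^d$ is drawn from the distribution $\mathcal{F}$, which has the following properties: $\varphi(x,y) = A_0 x + A_1 y$ where $A_0, A_1$ are $d\times d$ matrices with entries in $\{-\frac{1}{\sqrt{r}}, 0, \frac{1}{\sqrt{r}}\}$, each column of $A_0$ and of $A_1$ having exactly $r = \mathcal{O}(d\varepsilon)$ nonzero entries (sparse Johnson–Lindenstrauss matrices: positions of nonzeros chosen at random in each column, signs uniformly random), so that $\varphi$ can be evaluated in $\mathcal{O}(d^2\varepsilon)$ time, and for any fixed $x,y\in\mathbb{R}^d$, $\Pr_{\varphi\sim\mathcal{F}}\left(\|\varphi(x,y)\|^2 = (1\pm\varepsilon)(\|x\|^2+\|y\|^2)\right) = 1 - n^{-\Omega(1)}$. Procedure SingleSketch$(x)$: pick $k$ fully independent maps $\varphi_1,\ldots,\varphi_k \sim \mathcal{F}$; partition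 $x = (x_1,\ldots,x_m)$ into $s$ vectors $v^{(0)}_i = (x_{d(i-1)+1},\ldots,x_{di})$, $i=1,\ldots,s$; for $i = 1,\ldots,k$ and $j = 1,\ldots,2^{k-i}$ set $v^{(i)}_j = \varphi_i(v^{(i-1)}_{2j-1}, v^{(i-1)}_{2j})$; return $v = v^{(k)}_1$. "With high probability" means with probability at least $1-n^{-\Omega(1)}$. *)

theory Defs
  imports "HOL-Probability.Probability" "Jordan_Normal_Form.Matrix"
begin

definition l2_norm :: "real vec \<Rightarrow> real" where
  "l2_norm v = sqrt (scalar_prod v v)"

definition approx_within :: "real \<Rightarrow> real \<Rightarrow> real \<Rightarrow> bool" where
  "approx_within \<delta> a b \<longleftrightarrow> (1 - \<delta>) * b \<le> a \<and> a \<le> (1 + \<delta>) * b"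

text \<open>A pair \<open>(A0, A1)\<close> represents the map \<open>(x, y) \<mapsto> A0 x + A1 y\<close>.\<close>

type_synonym pair_map = "real mat \<times> real mat"

definition apply_map :: "pair_map \<Rightarrow> real vec \<Rightarrow> real vec \<Rightarrow> real vec" where
  "apply_map \<phi> x y = fst \<phi> *\<^sub>v x + snd \<phi> *\<^sub>v y"

definition sparse_sign_mats :: "nat \<Rightarrow> nat \<Rightarrow> real mat set" where
  "sparse_sign_mats d r =
    {A \<in> carrier_mat d d.
       elements_mat A \<subseteq> {- (1 / sqrt (real r)), 0, 1 / sqrt (real r)} \<and>
       (\<forall>j<d. card {i. i < d \<and> A $$ (i, j) \<noteq> 0} = r)}"

text \<open>For \<open>1 \<le> r \<le> d\<close> the set below is finite and nonempty, and the uniform distribution on it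
  amounts to the following: independently for each of the \<open>2d\<close> columns, the positions of the
  nonzero entries form a uniformly random \<open>r\<close>-subset of the rows, and the signs of these entries
  are independent and uniform.\<close>

definition sparse_jl :: "nat \<Rightarrow> nat \<Rightarrow> pair_map pmf" where
  "sparse_jl d r = pmf_of_set (sparse_sign_mats d r \<times> sparse_sign_mats d r)"

definition jl_guarantee :: "pair_map pmf \<Rightarrow> nat \<Rightarrow> real \<Rightarrow> real \<Rightarrow> bool" where
  "jl_guarantee F d \<epsilon> \<delta> \<longleftrightarrow>
    (\<forall>x \<in> carrier_vec d. \<forall>y \<in> carrier_vec d.
       measure_pmf.prob F
         {\<phi>. approx_within \<epsilon> ((l2_norm (apply_map \<phi> x y))\<^sup>2) ((l2_norm x)\<^sup>2 + (l2_norm y)\<^sup>2)}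
       \<ge> 1 - \<delta>)"

definition independent_maps :: "nat \<Rightarrow> pair_map pmf \<Rightarrow> (nat \<Rightarrow> pair_map) pmf" where
  "independent_maps k F = Pi_pmf {1..k} undefined (\<lambda>_. F)"

text \<open>\<open>sketch_node d \<phi> x i j\<close> is the vector $v^{(i)}_j$. Levels, blocks and maps are indexed from 1 as
  in $v^{(i)}_j$; the coordinates of vectors are indexed from 0.\<close>

fun sketch_node :: "nat \<Rightarrow> (nat \<Rightarrow> pair_map) \<Rightarrow> real vec \<Rightarrow> nat \<Rightarrow> nat \<Rightarrow> real vec" where
  "sketch_node d \<phi> x 0 j = vec d (\<lambda>l. x $ (d * (j - 1) + l))"
| "sketch_node d \<phi> x (Suc i) j =
     apply_map (\<phi> (Suc i)) (sketch_node d \<phi> x i (2 * j - 1)) (sketch_node d \<phi> x i (2 * j))"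

definition single_sketch :: "nat \<Rightarrow> nat \<Rightarrow> (nat \<Rightarrow> pair_map) \<Rightarrow> real vec \<Rightarrow> real vec" where
  "single_sketch d k \<phi> x = sketch_node d \<phi> x k 1"

definition linear_on_vecs :: "nat \<Rightarrow> nat \<Rightarrow> (real vec \<Rightarrow> real vec) \<Rightarrow> bool" where
  "linear_on_vecs m d f \<longleftrightarrow>
    (\<forall>x \<in> carrier_vec m. f x \<in> carrier_vec d) \<and>
    (\<forall>x \<in> carrier_vec m. \<forall>y \<in> carrier_vec m. f (x + y) = f x + f y) \<and>
    (\<forall>a. \<forall>x \<in> carrier_vec m. f (a \<cdot>\<^sub>v x) = a \<cdot>\<^sub>v f x)"

text \<open>Running time is measured in the unit-cost real RAM model. The functions below implement the
  procedure on arrays (represented by lists) and return the result together with the number of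
  steps. A random matrix is drawn and stored as a list of sparse columns, each being the list of
  its nonzero entries with their row indices. One step is charged for drawing and storing a nonzero
  entry, for an update \<open>w[i] := w[i] + a * c\<close>, for copying or initialising an array cell, and for
  each recursive call.\<close>

type_synonym sparse_cols = "(nat \<times> real) list list"

definition sparse_cols_of :: "real mat \<Rightarrow> sparse_cols" where
  "sparse_cols_of A =
    map (\<lambda>j. map (\<lambda>i. (i, A $$ (i, j))) (filter (\<lambda>i. A $$ (i, j) \<noteq> 0) [0..<dim_row A])) [0..<dim_col A]"

fun draw_cols :: "real mat \<Rightarrow> sparse_cols \<times> nat" where
  "draw_cols A = (let B = sparse_cols_of A in (B, (\<Sum>es\<leftarrow>B. length es + 1) + 1))"

fun draw_maps :: "pair_map list \<Rightarrow> (sparse_cols \<times> sparse_cols) list \<times> nat" where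
  "draw_maps [] = ([], 1)"
| "draw_maps ((A0, A1) # \<phi>s) =
    (let (B0, t0) = draw_cols A0;
         (B1, t1) = draw_cols A1;
         (Bs, t) = draw_maps \<phi>s
     in ((B0, B1) # Bs, t0 + t1 + t + 1))"

fun add_scaled_col :: "(nat \<times> real) list \<Rightarrow> real \<Rightarrow> real list \<Rightarrow> real list \<times> nat" where
  "add_scaled_col [] c w = (w, 1)"
| "add_scaled_col ((i, a) # es) c w =
    (let (w', t) = add_scaled_col es c (w[i := w ! i + a * c]) in (w', t + 2))"

fun add_mult :: "sparse_cols \<Rightarrow> real list \<Rightarrow> real list \<Rightarrow> real list \<times> nat" where
  "add_mult (es # B) (c # x) w =
    (let (w1, t1) = add_scaled_col es c w;
         (w2, t2) = add_mult B x w1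
     in (w2, t1 + t2 + 1))"
| "add_mult _ _ w = (w, 1)"

fun eval_map :: "nat \<Rightarrow> sparse_cols \<times> sparse_cols \<Rightarrow> real list \<Rightarrow> real list \<Rightarrow> real list \<times> nat" where
  "eval_map d (B0, B1) x y =
    (let (w0, t0) = add_mult B0 x (replicate d 0);
         (w1, t1) = add_mult B1 y w0
     in (w1, d + t0 + t1 + 1))"

fun combine_pairs ::
  "nat \<Rightarrow> sparse_cols \<times> sparse_cols \<Rightarrow> real list list \<Rightarrow> real list list \<times> nat" where
  "combine_pairs d B (u # v # vs) =
    (let (w, t) = eval_map d B u v;
         (ws, t') = combine_pairs d B vs
     in (w # ws, t + t' + 1))"
| "combine_pairs d B vs = (vs, 1)"

fun run_levels ::
  "nat \<Rightarrow> (sparse_cols \<times> sparse_cols) list \<Rightarrow> real list list \<Rightarrow> real list list \<times> nat" where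
  "run_levels d [] vs = (vs, 1)"
| "run_levels d (B # Bs) vs =
    (let (ws, t) = combine_pairs d B vs;
         (us, t') = run_levels d Bs ws
     in (us, t + t' + 1))"

fun split_blocks :: "nat \<Rightarrow> nat \<Rightarrow> real list \<Rightarrow> real list list \<times> nat" where
  "split_blocks d 0 xs = ([], 1)"
| "split_blocks d (Suc s) xs =
    (let (vs, t) = split_blocks d s (drop d xs) in (take d xs # vs, d + t + 1))"

definition single_sketch_run ::
  "nat \<Rightarrow> nat \<Rightarrow> (nat \<Rightarrow> pair_map) \<Rightarrow> real vec \<Rightarrow> real vec \<times> nat" where
  "single_sketch_run d k \<phi> x =
    (let (Bs, t0) = draw_maps (map \<phi> [1..<Suc k]);
         (vs, t1) = split_blocks d (2 ^ k) (list_of_vec x);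
         (ws, t2) = run_levels d Bs vs
     in (vec_of_list (hd ws), t0 + t1 + t2 + 1))"

end

theory Submission
  imports Defs
begin

text \<open>Let \<open>S\<^sub>i\<close> be the sum of the squared norms of the vectors on level \<open>i\<close>. For a single pair
  \<open>(x, y)\<close> with \<open>N = \<parallel>x\<parallel>\<^sup>2 + \<parallel>y\<parallel>\<^sup>2\<close>, the error \<open>Z = \<parallel>\<phi>(x, y)\<parallel>\<^sup>2 - N\<close> has mean \<open>0\<close> and second moment at
  most \<open>2 N\<^sup>2 / d\<close>, since the signs are symmetric and the expected square of each entry is \<open>1 / d\<close>. By
  Cauchy-Schwarz and the guarantee \<open>P(\<bar>Z\<bar> > \<epsilon> N) \<le> n\<^sup>-\<^sup>c\<close>, the part of \<open>\<bar>Z\<bar>\<close> on the failure event has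
  expectation at most \<open>sqrt (2 / d) n\<^sup>-\<^sup>c\<^sup>/\<^sup>2 N = O(\<epsilon> n\<^sup>-\<^sup>c\<^sup>/\<^sup>2 N)\<close>. Hence
  \<open>\<bar>S\<^sub>i\<^sub>+\<^sub>1 - S\<^sub>i\<bar> \<le> \<epsilon> S\<^sub>i + B\<^sub>i\<close>, where the total of the \<open>B\<^sub>i\<close> has expectation \<open>O(k \<epsilon> n\<^sup>-\<^sup>c\<^sup>/\<^sup>2 \<parallel>x\<parallel>\<^sup>2)\<close>
  because \<open>E S\<^sub>i = \<parallel>x\<parallel>\<^sup>2\<close>. By Markov's inequality this total is \<open>O(k \<epsilon> \<parallel>x\<parallel>\<^sup>2)\<close> with probability at least
  \<open>1 - n\<^sup>-\<^sup>c\<^sup>/\<^sup>2\<close>, and a discrete Gronwall argument bounds \<open>\<bar>S\<^sub>k - S\<^sub>0\<bar>\<close>. No union bound over the nodes is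
  needed, which matters because \<open>m\<close> is not assumed to be polynomial in \<open>n\<close>.\<close>

section \<open>Second moment of the distortion of random columns with symmetric entries\<close>

text \<open>Sums over \<open>\<Omega>\<close> stand for expectations under the uniform distribution,
  up to the factor \<open>card \<Omega>\<close>. Independence of signs and positions enters only
  through two symmetries: negating a single entry, and bringing entry \<open>i'\<close> of a column
  to row \<open>i\<close> while all other columns stay fixed.\<close>

locale symmetric_columns =
  fixes \<Omega> :: "'w set" and P :: "'p set" and d :: nat and a :: "'w \<Rightarrow> 'p \<Rightarrow> nat \<Rightarrow> real"
  assumes finite_index: "finite P"
    and d_pos: "d > 0"
    and unit_column: "\<omega> \<in> \<Omega> \<Longrightarrow> p \<in> P \<Longrightarrow> (\<Sum>i<d. (a \<omega> p i)\<^sup>2) = 1"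
    and flip: "p \<in> P \<Longrightarrow> i < d \<Longrightarrow> \<exists>\<tau>. bij_betw \<tau> \<Omega> \<Omega> \<and>
      (\<forall>\<omega>\<in>\<Omega>. \<forall>q\<in>P. \<forall>l<d. a (\<tau> \<omega>) q l = (if q = p \<and> l = i then - a \<omega> q l else a \<omega> q l))"
    and swap: "p \<in> P \<Longrightarrow> i < d \<Longrightarrow> i' < d \<Longrightarrow> \<exists>\<tau>. bij_betw \<tau> \<Omega> \<Omega> \<and>
      (\<forall>\<omega>\<in>\<Omega>. a (\<tau> \<omega>) p i = a \<omega> p i' \<and> (\<forall>q\<in>P - {p}. \<forall>l<d. a (\<tau> \<omega>) q l = a \<omega> q l))"
begin

text \<open>Reindexing by the sign flip of entry \<open>(p, i)\<close> turns the sum into its own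
  negative, because the condition on \<open>h\<close> says that \<open>h\<close> cannot see that
  entry.\<close>

lemma sum_odd_eq_0:
  assumes "p \<in> P" "i < d"
    and h: "\<And>\<omega> \<omega>'. (\<And>q l. q \<in> P \<Longrightarrow> l < d \<Longrightarrow> (q, l) \<noteq> (p, i) \<Longrightarrow> a \<omega> q l = a \<omega>' q l) \<Longrightarrow> h \<omega> = h \<omega>'"
  shows "(\<Sum>\<omega>\<in>\<Omega>. h \<omega> * a \<omega> p i) = (0::real)"
proof -
  obtain \<tau> where \<tau>: "bij_betw \<tau> \<Omega> \<Omega>"
    "\<And>\<omega> q l. \<omega> \<in> \<Omega> \<Longrightarrow> q \<in> P \<Longrightarrow> l < d \<Longrightarrow> a (\<tau> \<omega>) q l = (if q = p \<and> l = i then - a \<omega> q l else a \<omega> q l)"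
    using flip[OF assms(1,2)] by blast
  have "(\<Sum>\<omega>\<in>\<Omega>. h \<omega> * a \<omega> p i) = (\<Sum>\<omega>\<in>\<Omega>. h (\<tau> \<omega>) * a (\<tau> \<omega>) p i)"
    by (rule sum.reindex_bij_betw[OF \<tau>(1), symmetric])
  also have "\<dots> = (\<Sum>\<omega>\<in>\<Omega>. - (h \<omega> * a \<omega> p i))"
  proof (rule sum.cong)
    fix \<omega> assume "\<omega> \<in> \<Omega>"
    then have "h (\<tau> \<omega>) = h \<omega>" by (intro h) (auto simp: \<tau>)
    then show "h (\<tau> \<omega>) * a (\<tau> \<omega>) p i = - (h \<omega> * a \<omega> p i)"
      using \<tau>(2)[OF \<open>\<omega> \<in> \<Omega>\<close> assms(1,2)] by simp
  qed simp
  finally show ?thesis by (simp add: sum_negf)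
qed

text \<open>By the swap symmetry the sum is the same for every row, and over the \<open>d\<close>
  rows the squares add up to 1. Since \<open>h\<close> may depend on all other columns, this says
  that a squared entry has mean \<open>1 / d\<close> even given those columns.\<close>

lemma sum_square_entry:
  assumes "p \<in> P" "i < d"
    and h: "\<And>\<omega> \<omega>'. (\<And>q l. q \<in> P - {p} \<Longrightarrow> l < d \<Longrightarrow> a \<omega> q l = a \<omega>' q l) \<Longrightarrow> h \<omega> = h \<omega>'"
  shows "(\<Sum>\<omega>\<in>\<Omega>. h \<omega> * (a \<omega> p i)\<^sup>2) = (\<Sum>\<omega>\<in>\<Omega>. h \<omega>) / real d"
proof -
  have swapped: "(\<Sum>\<omega>\<in>\<Omega>. h \<omega> * (a \<omega> p i)\<^sup>2) = (\<Sum>\<omega>\<in>\<Omega>. h \<omega> * (a \<omega> p i')\<^sup>2)" if i': "i' < d" for i'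
  proof -
    obtain \<tau> where \<tau>: "bij_betw \<tau> \<Omega> \<Omega>" "\<And>\<omega>. \<omega> \<in> \<Omega> \<Longrightarrow> a (\<tau> \<omega>) p i = a \<omega> p i'"
      "\<And>\<omega> q l. \<omega> \<in> \<Omega> \<Longrightarrow> q \<in> P - {p} \<Longrightarrow> l < d \<Longrightarrow> a (\<tau> \<omega>) q l = a \<omega> q l"
      using swap[OF assms(1,2) i'] by blast
    have "(\<Sum>\<omega>\<in>\<Omega>. h \<omega> * (a \<omega> p i)\<^sup>2) = (\<Sum>\<omega>\<in>\<Omega>. h (\<tau> \<omega>) * (a (\<tau> \<omega>) p i)\<^sup>2)"
      by (rule sum.reindex_bij_betw[OF \<tau>(1), symmetric])
    also have "\<dots> = (\<Sum>\<omega>\<in>\<Omega>. h \<omega> * (a \<omega> p i')\<^sup>2)"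
    proof (rule sum.cong)
      fix \<omega> assume "\<omega> \<in> \<Omega>"
      then have "h (\<tau> \<omega>) = h \<omega>" by (intro h) (auto simp: \<tau>(3))
      then show "h (\<tau> \<omega>) * (a (\<tau> \<omega>) p i)\<^sup>2 = h \<omega> * (a \<omega> p i')\<^sup>2"
        using \<tau>(2)[OF \<open>\<omega> \<in> \<Omega>\<close>] by simp
    qed simp
    finally show ?thesis .
  qed
  have "real d * (\<Sum>\<omega>\<in>\<Omega>. h \<omega> * (a \<omega> p i)\<^sup>2) = (\<Sum>i'<d. \<Sum>\<omega>\<in>\<Omega>. h \<omega> * (a \<omega> p i')\<^sup>2)"
    using swapped by (simp flip: swapped)
  also have "\<dots> = (\<Sum>\<omega>\<in>\<Omega>. \<Sum>i'<d. h \<omega> * (a \<omega> p i')\<^sup>2)"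
    by (rule sum.swap)
  also have "\<dots> = (\<Sum>\<omega>\<in>\<Omega>. h \<omega>)"
    using unit_column assms(1) by (intro sum.cong) (auto simp flip: sum_distrib_left)
  finally show ?thesis
    using d_pos by (simp add: field_simps)
qed

text \<open>The set \<open>F\<close> of columns is a parameter so that the moments can be computed
  by induction over the columns.\<close>

definition image_coord :: "('p \<Rightarrow> real) \<Rightarrow> 'p set \<Rightarrow> 'w \<Rightarrow> nat \<Rightarrow> real" where
  "image_coord v F \<omega> i = (\<Sum>p\<in>F. v p * a \<omega> p i)"

definition distortion :: "('p \<Rightarrow> real) \<Rightarrow> 'p set \<Rightarrow> 'w \<Rightarrow> real" where
  "distortion v F \<omega> = (\<Sum>i<d. (image_coord v F \<omega> i)\<^sup>2) - (\<Sum>p\<in>F. (v p)\<^sup>2)"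

lemma image_coord_cong:
  "(\<And>q. q \<in> F \<Longrightarrow> a \<omega> q i = a \<omega>' q i) \<Longrightarrow> image_coord v F \<omega> i = image_coord v F \<omega>' i"
  unfolding image_coord_def by (intro sum.cong) auto

lemma distortion_cong:
  "(\<And>q i. q \<in> F \<Longrightarrow> i < d \<Longrightarrow> a \<omega> q i = a \<omega>' q i) \<Longrightarrow> distortion v F \<omega> = distortion v F \<omega>'"
  unfolding distortion_def using image_coord_cong[of F \<omega> _ \<omega>' v] by auto

text \<open>Adding the columns one at a time makes the distortion a martingale whose increments are
  \<open>2 v\<^sub>p\<close> times the inner product of the new column with the partial image.\<close>

lemma distortion_moments:
  assumes "F \<subseteq> P"
  shows "(\<Sum>\<omega>\<in>\<Omega>. distortion v F \<omega>) = 0"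
    and "(\<Sum>\<omega>\<in>\<Omega>. (distortion v F \<omega>)\<^sup>2) \<le> 2 / real d * (\<Sum>p\<in>F. (v p)\<^sup>2)\<^sup>2 * real (card \<Omega>)"
proof -
  have "finite F" using assms finite_index finite_subset by blast
  then have "(\<Sum>\<omega>\<in>\<Omega>. distortion v F \<omega>) = 0 \<and>
    (\<Sum>\<omega>\<in>\<Omega>. (distortion v F \<omega>)\<^sup>2) \<le> 2 / real d * (\<Sum>p\<in>F. (v p)\<^sup>2)\<^sup>2 * real (card \<Omega>)"
    using assms
  proof (induction F rule: finite_induct)
    case empty
    then show ?case by (simp add: distortion_def image_coord_def)
  next
    case (insert p F)
    define D where "D \<omega> = (\<Sum>i<d. image_coord v F \<omega> i * a \<omega> p i)" for \<omega>
    define N where "N = (\<Sum>q\<in>F. (v q)\<^sup>2)"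
    have p: "p \<in> P" "p \<notin> F" "F \<subseteq> P" "F \<subseteq> P - {p}" using insert by auto
    have IH: "(\<Sum>\<omega>\<in>\<Omega>. distortion v F \<omega>) = 0"
      "(\<Sum>\<omega>\<in>\<Omega>. (distortion v F \<omega>)\<^sup>2) \<le> 2 / real d * N\<^sup>2 * real (card \<Omega>)"
      using insert p by (auto simp: N_def)
    have step: "distortion v (insert p F) \<omega> = distortion v F \<omega> + 2 * v p * D \<omega>" if "\<omega> \<in> \<Omega>" for \<omega>
    proof -
      have "(\<Sum>i<d. (image_coord v (insert p F) \<omega> i)\<^sup>2) =
          (\<Sum>i<d. (image_coord v F \<omega> i)\<^sup>2 + 2 * v p * (image_coord v F \<omega> i * a \<omega> p i) + (v p)\<^sup>2 * (a \<omega> p i)\<^sup>2)"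
        using insert p by (intro sum.cong) (auto simp: image_coord_def power2_eq_square algebra_simps)
      also have "\<dots> = (\<Sum>i<d. (image_coord v F \<omega> i)\<^sup>2) + 2 * v p * D \<omega> + (v p)\<^sup>2"
        using unit_column[OF that p(1)] by (simp add: sum.distrib D_def flip: sum_distrib_left)
      finally show ?thesis
        using insert p by (simp add: distortion_def)
    qed
    \<comment> \<open>Each summand of \<open>D\<close> is odd in its own entry of column
      \<open>p\<close>, so \<open>D\<close> is uncorrelated with every function of the earlier
      columns.\<close>
    have vanish: "(\<Sum>\<omega>\<in>\<Omega>. h \<omega> * D \<omega>) = 0"
      if h: "\<And>\<omega> \<omega>'. (\<And>q l. q \<in> F \<Longrightarrow> l < d \<Longrightarrow> a \<omega> q l = a \<omega>' q l) \<Longrightarrow> h \<omega> = h \<omega>'" for h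
    proof -
      have "(\<Sum>\<omega>\<in>\<Omega>. h \<omega> * D \<omega>) = (\<Sum>i<d. \<Sum>\<omega>\<in>\<Omega>. h \<omega> * image_coord v F \<omega> i * a \<omega> p i)"
        unfolding D_def sum_distrib_left by (subst sum.swap) (simp add: mult.assoc)
      also have "\<dots> = 0"
      proof (rule sum.neutral, rule ballI, rule sum_odd_eq_0)
        fix i \<omega> \<omega>' assume i: "i \<in> {..<d}"
          and eq: "\<And>q l. q \<in> P \<Longrightarrow> l < d \<Longrightarrow> (q, l) \<noteq> (p, i) \<Longrightarrow> a \<omega> q l = a \<omega>' q l"
        have "h \<omega> = h \<omega>'" using p eq by (intro h) auto
        moreover have "image_coord v F \<omega> i = image_coord v F \<omega>' i"
          using p eq i by (intro image_coord_cong) auto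
        ultimately show "h \<omega> * image_coord v F \<omega> i = h \<omega>' * image_coord v F \<omega>' i" by simp
      qed (use p in auto)
      finally show ?thesis .
    qed
    have mean_zero: "(\<Sum>\<omega>\<in>\<Omega>. D \<omega>) = 0" using vanish[of "\<lambda>_. 1"] by simp
    have cross_zero: "(\<Sum>\<omega>\<in>\<Omega>. distortion v F \<omega> * D \<omega>) = 0"
      by (rule vanish) (rule distortion_cong)
    \<comment> \<open>For different rows the product is odd in entry \<open>(p, l)\<close>; the
      remaining factors, including \<open>a \<omega> p i\<close>, do not involve that entry.\<close>
    have offdiag: "(\<Sum>\<omega>\<in>\<Omega>. image_coord v F \<omega> i * a \<omega> p i * (image_coord v F \<omega> l * a \<omega> p l)) = 0"
      if "i < d" "l < d" "i \<noteq> l" for i l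
    proof -
      have "(\<Sum>\<omega>\<in>\<Omega>. (image_coord v F \<omega> i * a \<omega> p i * image_coord v F \<omega> l) * a \<omega> p l) = 0"
      proof (rule sum_odd_eq_0)
        fix \<omega> \<omega>' assume eq: "\<And>q j. q \<in> P \<Longrightarrow> j < d \<Longrightarrow> (q, j) \<noteq> (p, l) \<Longrightarrow> a \<omega> q j = a \<omega>' q j"
        have "image_coord v F \<omega> j = image_coord v F \<omega>' j" if "j < d" for j
          using p eq that by (intro image_coord_cong) auto
        then show "image_coord v F \<omega> i * a \<omega> p i * image_coord v F \<omega> l =
            image_coord v F \<omega>' i * a \<omega>' p i * image_coord v F \<omega>' l"
          using eq[of p i] p that by simp
      qed (use p that in auto)
      then show ?thesis by (simp add: mult.assoc)
    qed
    have "(\<Sum>\<omega>\<in>\<Omega>. (D \<omega>)\<^sup>2) =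
        (\<Sum>i<d. \<Sum>l<d. \<Sum>\<omega>\<in>\<Omega>. image_coord v F \<omega> i * a \<omega> p i * (image_coord v F \<omega> l * a \<omega> p l))"
      unfolding D_def power2_eq_square sum_product
      by (subst sum.swap, intro sum.cong refl sum.swap)
    also have "\<dots> = (\<Sum>i<d. \<Sum>l<d. if l = i then \<Sum>\<omega>\<in>\<Omega>. (image_coord v F \<omega> i)\<^sup>2 * (a \<omega> p i)\<^sup>2 else 0)"
    proof (intro sum.cong refl)
      fix i l assume "i \<in> {..<d}" "l \<in> {..<d}"
      then show "(\<Sum>\<omega>\<in>\<Omega>. image_coord v F \<omega> i * a \<omega> p i * (image_coord v F \<omega> l * a \<omega> p l)) =
          (if l = i then \<Sum>\<omega>\<in>\<Omega>. (image_coord v F \<omega> i)\<^sup>2 * (a \<omega> p i)\<^sup>2 else 0)"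
        using offdiag[of i l] by (cases "l = i") (simp_all add: power2_eq_square mult_ac)
    qed
    also have "\<dots> = (\<Sum>i<d. \<Sum>\<omega>\<in>\<Omega>. (image_coord v F \<omega> i)\<^sup>2 * (a \<omega> p i)\<^sup>2)"
      by simp
    \<comment> \<open>The partial image does not involve column \<open>p\<close>, so the squared
      entry may be replaced by its mean \<open>1 / d\<close>.\<close>
    also have "\<dots> = (\<Sum>i<d. (\<Sum>\<omega>\<in>\<Omega>. (image_coord v F \<omega> i)\<^sup>2) / real d)"
    proof (intro sum.cong refl sum_square_entry)
      fix i \<omega> \<omega>' assume "i \<in> {..<d}" "\<And>q l. q \<in> P - {p} \<Longrightarrow> l < d \<Longrightarrow> a \<omega> q l = a \<omega>' q l"
      then show "(image_coord v F \<omega> i)\<^sup>2 = (image_coord v F \<omega>' i)\<^sup>2"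
        using p by (metis image_coord_cong lessThan_iff subsetD)
    qed (use p in auto)
    also have "\<dots> = (\<Sum>\<omega>\<in>\<Omega>. \<Sum>i<d. (image_coord v F \<omega> i)\<^sup>2) / real d"
      by (subst sum.swap) (simp add: sum_divide_distrib)
    also have "(\<Sum>\<omega>\<in>\<Omega>. \<Sum>i<d. (image_coord v F \<omega> i)\<^sup>2) = (\<Sum>\<omega>\<in>\<Omega>. distortion v F \<omega> + N)"
      by (simp add: distortion_def N_def)
    also have "\<dots> = real (card \<Omega>) * N"
      using IH by (simp add: sum.distrib)
    finally have D2: "(\<Sum>\<omega>\<in>\<Omega>. (D \<omega>)\<^sup>2) = real (card \<Omega>) * N / real d" .
    have "(\<Sum>\<omega>\<in>\<Omega>. distortion v (insert p F) \<omega>) = 0"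
      using IH mean_zero by (simp add: step sum.distrib flip: sum_distrib_left)
    moreover have "(\<Sum>\<omega>\<in>\<Omega>. (distortion v (insert p F) \<omega>)\<^sup>2) =
       (\<Sum>\<omega>\<in>\<Omega>. (distortion v F \<omega>)\<^sup>2 + 4 * v p * (distortion v F \<omega> * D \<omega>) + 4 * (v p)\<^sup>2 * (D \<omega>)\<^sup>2)"
      by (intro sum.cong refl) (simp add: step power2_eq_square algebra_simps)
    moreover have "\<dots> = (\<Sum>\<omega>\<in>\<Omega>. (distortion v F \<omega>)\<^sup>2) + 4 * (v p)\<^sup>2 * (real (card \<Omega>) * N / real d)"
      using cross_zero by (simp add: sum.distrib D2 flip: sum_distrib_left)
    moreover have "\<dots> \<le> 2 / real d * N\<^sup>2 * real (card \<Omega>) + 4 * (v p)\<^sup>2 * (real (card \<Omega>) * N / real d)"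
      using IH by simp
    \<comment> \<open>Expanding the square on the right gives the two terms on the left exactly,
      plus the nonnegative fourth power of \<open>v p\<close>.\<close>
    moreover have "\<dots> \<le> 2 / real d * ((v p)\<^sup>2 + N)\<^sup>2 * real (card \<Omega>)"
    proof -
      have "0 \<le> 2 / real d * ((v p)\<^sup>2)\<^sup>2 * real (card \<Omega>)" by simp
      then show ?thesis using d_pos by (simp add: field_simps power2_eq_square)
    qed
    ultimately show ?case
      using insert p by (simp add: N_def)
  qed
  then show "(\<Sum>\<omega>\<in>\<Omega>. distortion v F \<omega>) = 0"
    "(\<Sum>\<omega>\<in>\<Omega>. (distortion v F \<omega>)\<^sup>2) \<le> 2 / real d * (\<Sum>p\<in>F. (v p)\<^sup>2)\<^sup>2 * real (card \<Omega>)"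
    by auto
qed

end

section \<open>Sparse sign matrices\<close>

lemma bij_betw_involution:
  assumes "\<And>x. x \<in> S \<Longrightarrow> f x \<in> S" "\<And>x. x \<in> S \<Longrightarrow> f (f x) = x"
  shows "bij_betw f S S"
  using assms by (intro bij_betw_byWitness[where f' = f]) (blast | simp add: image_subset_iff)+

lemma sparse_sign_matsI:
  assumes "A \<in> carrier_mat d d"
    and "\<And>i j. i < d \<Longrightarrow> j < d \<Longrightarrow> A $$ (i, j) \<in> {- (1 / sqrt (real r)), 0, 1 / sqrt (real r)}"
    and "\<And>j. j < d \<Longrightarrow> card {i. i < d \<and> A $$ (i, j) \<noteq> 0} = r"
  shows "A \<in> sparse_sign_mats d r"
proof -
  have "elements_mat A \<subseteq> {- (1 / sqrt (real r)), 0, 1 / sqrt (real r)}"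
  proof
    fix e assume "e \<in> elements_mat A"
    then obtain i j where "i < dim_row A" "j < dim_col A" "e = A $$ (i, j)"
      using elements_matD by blast
    then show "e \<in> {- (1 / sqrt (real r)), 0, 1 / sqrt (real r)}"
      using assms(1) assms(2)[of i j] by simp
  qed
  then show ?thesis using assms(1,3) by (simp add: sparse_sign_mats_def)
qed

lemma sparse_sign_matsD:
  assumes "A \<in> sparse_sign_mats d r"
  shows "A \<in> carrier_mat d d"
    and "i < d \<Longrightarrow> j < d \<Longrightarrow> A $$ (i, j) \<in> {- (1 / sqrt (real r)), 0, 1 / sqrt (real r)}"
    and "j < d \<Longrightarrow> card {i. i < d \<and> A $$ (i, j) \<noteq> 0} = r"
proof -
  have A: "A \<in> carrier_mat d d" "elements_mat A \<subseteq> {- (1 / sqrt (real r)), 0, 1 / sqrt (real r)}"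
    "\<forall>j<d. card {i. i < d \<and> A $$ (i, j) \<noteq> 0} = r"
    using assms by (simp_all add: sparse_sign_mats_def)
  show "A \<in> carrier_mat d d" by (rule A)
  show "A $$ (i, j) \<in> {- (1 / sqrt (real r)), 0, 1 / sqrt (real r)}" if "i < d" "j < d"
    by (rule subsetD[OF A(2) elements_matI[OF A(1) that refl]])
  show "card {i. i < d \<and> A $$ (i, j) \<noteq> 0} = r" if "j < d"
    using A(3) that by blast
qed

lemma finite_sparse_sign_mats: "finite (sparse_sign_mats d r)"
proof -
  let ?V = "{- (1 / sqrt (real r)), 0, 1 / sqrt (real r)}"
  have "sparse_sign_mats d r \<subseteq> mat d d ` (({..<d} \<times> {..<d}) \<rightarrow>\<^sub>E ?V)"
  proof
    fix A assume A: "A \<in> sparse_sign_mats d r"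
    let ?f = "restrict (\<lambda>ij. A $$ ij) ({..<d} \<times> {..<d})"
    have "A = mat d d ?f" using sparse_sign_matsD(1)[OF A] by (intro eq_matI) auto
    moreover have "?f \<in> ({..<d} \<times> {..<d}) \<rightarrow>\<^sub>E ?V"
      using sparse_sign_matsD(2)[OF A] by (auto simp: PiE_iff)
    ultimately show "A \<in> mat d d ` (({..<d} \<times> {..<d}) \<rightarrow>\<^sub>E ?V)" by blast
  qed
  then show ?thesis
    by (rule finite_subset) (intro finite_imageI finite_PiE, auto)
qed

lemma sparse_sign_mats_nonempty:
  assumes "1 \<le> r" "r \<le> d"
  shows "sparse_sign_mats d r \<noteq> {}"
proof -
  have "mat d d (\<lambda>(i, j). if i < r then 1 / sqrt (real r) else 0) \<in> sparse_sign_mats d r" (is "?A \<in> _")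
  proof (rule sparse_sign_matsI)
    fix j assume "j < d"
    then have "{i. i < d \<and> ?A $$ (i, j) \<noteq> 0} = {..<r}"
      using assms by (auto split: if_splits)
    then show "card {i. i < d \<and> ?A $$ (i, j) \<noteq> 0} = r" by simp
  qed auto
  then show ?thesis by blast
qed

lemma sum_squares_column_sparse_sign_mats:
  assumes "A \<in> sparse_sign_mats d r" "j < d" "1 \<le> r"
  shows "(\<Sum>i<d. (A $$ (i, j))\<^sup>2) = 1"
proof -
  have "(\<Sum>i<d. (A $$ (i, j))\<^sup>2) = (\<Sum>i<d. if A $$ (i, j) \<noteq> 0 then 1 / real r else 0)"
  proof (rule sum.cong)
    fix i assume "i \<in> {..<d}"
    then consider "A $$ (i, j) = 0" | "A $$ (i, j) = 1 / sqrt (real r)" | "A $$ (i, j) = - (1 / sqrt (real r))"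
      using sparse_sign_matsD(2)[OF assms(1), of i j] assms(2) by auto
    then show "(A $$ (i, j))\<^sup>2 = (if A $$ (i, j) \<noteq> 0 then 1 / real r else 0)"
      using assms(3) by cases (simp_all add: power_divide)
  qed simp
  also have "\<dots> = (\<Sum>i | i < d \<and> A $$ (i, j) \<noteq> 0. 1 / real r)"
    by (rule sum.mono_neutral_cong_right) auto
  also have "\<dots> = 1"
    using sparse_sign_matsD(3)[OF assms(1,2)] assms(3) by simp
  finally show ?thesis .
qed

text \<open>Negating an entry preserves the support of its column, and the set of admissible values
  is symmetric about 0; the map is its own inverse.\<close>

lemma sparse_sign_mats_flip:
  assumes "i < d" "j < d"
  shows "\<exists>\<tau>. bij_betw \<tau> (sparse_sign_mats d r) (sparse_sign_mats d r) \<and>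
    (\<forall>A\<in>sparse_sign_mats d r. \<forall>l<d. \<forall>q<d.
      \<tau> A $$ (l, q) = (if q = j \<and> l = i then - A $$ (l, q) else A $$ (l, q)))"
proof -
  define \<tau> :: "real mat \<Rightarrow> real mat"
    where "\<tau> A = mat d d (\<lambda>(l, q). if q = j \<and> l = i then - A $$ (l, q) else A $$ (l, q))" for A
  have "bij_betw \<tau> (sparse_sign_mats d r) (sparse_sign_mats d r)"
  proof (rule bij_betw_involution)
    fix A assume A: "A \<in> sparse_sign_mats d r"
    show "\<tau> (\<tau> A) = A"
      using sparse_sign_matsD(1)[OF A] by (intro eq_matI) (auto simp: \<tau>_def)
    show "\<tau> A \<in> sparse_sign_mats d r"
    proof (rule sparse_sign_matsI)
      fix q assume q: "q < d"
      then have "{l. l < d \<and> \<tau> A $$ (l, q) \<noteq> 0} = {l. l < d \<and> A $$ (l, q) \<noteq> 0}"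
        by (auto simp: \<tau>_def split: if_splits)
      then show "card {l. l < d \<and> \<tau> A $$ (l, q) \<noteq> 0} = r"
        using sparse_sign_matsD(3)[OF A q] by simp
    next
      fix l q assume "l < d" "q < d"
      then show "\<tau> A $$ (l, q) \<in> {- (1 / sqrt (real r)), 0, 1 / sqrt (real r)}"
        using sparse_sign_matsD(2)[OF A, of l q] by (auto simp: \<tau>_def)
    qed (simp add: \<tau>_def)
  qed
  moreover have "\<forall>A\<in>sparse_sign_mats d r. \<forall>l<d. \<forall>q<d.
      \<tau> A $$ (l, q) = (if q = j \<and> l = i then - A $$ (l, q) else A $$ (l, q))"
    by (simp add: \<tau>_def)
  ultimately show ?thesis by blast
qed

text \<open>Transposing two rows inside column \<open>j\<close> alone preserves the number of
  nonzero entries of that column, and is an involution.\<close>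

lemma sparse_sign_mats_swap:
  assumes "i < d" "i' < d" "j < d"
  shows "\<exists>\<tau>. bij_betw \<tau> (sparse_sign_mats d r) (sparse_sign_mats d r) \<and>
    (\<forall>A\<in>sparse_sign_mats d r. \<tau> A $$ (i, j) = A $$ (i', j) \<and>
      (\<forall>l<d. \<forall>q<d. q \<noteq> j \<longrightarrow> \<tau> A $$ (l, q) = A $$ (l, q)))"
proof -
  let ?t = "Transposition.transpose i i'"
  define \<tau> :: "real mat \<Rightarrow> real mat"
    where "\<tau> A = mat d d (\<lambda>(l, q). if q = j then A $$ (?t l, q) else A $$ (l, q))" for A
  have t: "?t l < d \<longleftrightarrow> l < d" for l
    using assms by (auto simp: Transposition.transpose_def)
  have "bij_betw \<tau> (sparse_sign_mats d r) (sparse_sign_mats d r)"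
  proof (rule bij_betw_involution)
    fix A assume A: "A \<in> sparse_sign_mats d r"
    show "\<tau> (\<tau> A) = A"
      using sparse_sign_matsD(1)[OF A] by (intro eq_matI) (simp_all add: \<tau>_def t)
    show "\<tau> A \<in> sparse_sign_mats d r"
    proof (rule sparse_sign_matsI)
      fix q assume q: "q < d"
      have "card {l. l < d \<and> \<tau> A $$ (l, q) \<noteq> 0} = card {l. l < d \<and> A $$ (l, q) \<noteq> 0}"
      proof (cases "q = j")
        case True
        then have iff: "l < d \<and> \<tau> A $$ (l, q) \<noteq> 0 \<longleftrightarrow> ?t l < d \<and> A $$ (?t l, q) \<noteq> 0" for l
          using q t[of l] by (auto simp: \<tau>_def)
        have "bij_betw ?t {l. ?t l < d \<and> A $$ (?t l, q) \<noteq> 0} {l. l < d \<and> A $$ (l, q) \<noteq> 0}"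
          by (rule bij_betw_byWitness[where f' = ?t]) (simp_all add: image_subset_iff)
        then show ?thesis unfolding iff by (rule bij_betw_same_card)
      next
        case False
        then show ?thesis using q by (intro arg_cong[of _ _ card]) (auto simp: \<tau>_def)
      qed
      then show "card {l. l < d \<and> \<tau> A $$ (l, q) \<noteq> 0} = r"
        using sparse_sign_matsD(3)[OF A q] by simp
    next
      fix l q assume "l < d" "q < d"
      then show "\<tau> A $$ (l, q) \<in> {- (1 / sqrt (real r)), 0, 1 / sqrt (real r)}"
        using sparse_sign_matsD(2)[OF A, of l q] sparse_sign_matsD(2)[OF A, of "?t l" q] t[of l]
        by (cases "q = j") (simp_all add: \<tau>_def)
    qed (simp add: \<tau>_def)
  qed
  moreover have "\<forall>A\<in>sparse_sign_mats d r. \<tau> A $$ (i, j) = A $$ (i', j) \<and>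
      (\<forall>l<d. \<forall>q<d. q \<noteq> j \<longrightarrow> \<tau> A $$ (l, q) = A $$ (l, q))"
    using assms by (simp add: \<tau>_def)
  ultimately show ?thesis by blast
qed

text \<open>The pair \<open>(b, j)\<close> indexes column \<open>j\<close> of the first (\<open>b\<close> false) or second (\<open>b\<close> true) matrix.\<close>

definition pair_entry :: "pair_map \<Rightarrow> bool \<times> nat \<Rightarrow> nat \<Rightarrow> real" where
  "pair_entry \<phi> p i = (if fst p then snd \<phi> else fst \<phi>) $$ (i, snd p)"

text \<open>A symmetry of one matrix acts on the pair through the component that contains column
  \<open>p\<close> and is the identity on the other.\<close>

lemma symmetric_columns_sparse_pairs:
  assumes "1 \<le> r" "r \<le> d"
  shows "symmetric_columns (sparse_sign_mats d r \<times> sparse_sign_mats d r) (UNIV \<times> {..<d}) d pair_entry"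
proof
  let ?S = "sparse_sign_mats d r"
  let ?lift = "\<lambda>b \<tau> \<omega>. if b then (fst \<omega>, \<tau> (snd \<omega>)) else (\<tau> (fst \<omega>), snd \<omega>)"
  have lift: "bij_betw (?lift b \<tau>) (?S \<times> ?S) (?S \<times> ?S)" if "bij_betw \<tau> ?S ?S"
    for b and \<tau> :: "real mat \<Rightarrow> real mat"
  proof -
    have "bij_betw (map_prod (if b then id else \<tau>) (if b then \<tau> else id)) (?S \<times> ?S) (?S \<times> ?S)"
      using that by (intro bij_betw_map_prod) auto
    also have "map_prod (if b then id else \<tau>) (if b then \<tau> else id) = ?lift b \<tau>"
      by auto
    finally show ?thesis .
  qed
  show "finite (UNIV \<times> {..<d} :: (bool \<times> nat) set)" by simp
  show "0 < d" using assms by simp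
  show "(\<Sum>i<d. (pair_entry \<omega> p i)\<^sup>2) = 1" if "\<omega> \<in> ?S \<times> ?S" "p \<in> UNIV \<times> {..<d}" for \<omega> p
    using that assms by (auto simp: pair_entry_def sum_squares_column_sparse_sign_mats)
  show "\<exists>\<tau>. bij_betw \<tau> (?S \<times> ?S) (?S \<times> ?S) \<and>
      (\<forall>\<omega>\<in>?S \<times> ?S. \<forall>q\<in>UNIV \<times> {..<d}. \<forall>l<d.
        pair_entry (\<tau> \<omega>) q l = (if q = p \<and> l = i then - pair_entry \<omega> q l else pair_entry \<omega> q l))"
    if p: "p \<in> UNIV \<times> {..<d}" "i < d" for p i
  proof -
    obtain \<tau> where \<tau>: "bij_betw \<tau> ?S ?S" "\<And>A l q. A \<in> ?S \<Longrightarrow> l < d \<Longrightarrow> q < d \<Longrightarrow>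
        \<tau> A $$ (l, q) = (if q = snd p \<and> l = i then - A $$ (l, q) else A $$ (l, q))"
      using sparse_sign_mats_flip[of i d "snd p" r] p by force
    show ?thesis
      by (rule exI[of _ "?lift (fst p) \<tau>"], intro conjI lift \<tau>)
        (auto simp: pair_entry_def \<tau>(2) prod_eq_iff)
  qed
  show "\<exists>\<tau>. bij_betw \<tau> (?S \<times> ?S) (?S \<times> ?S) \<and>
      (\<forall>\<omega>\<in>?S \<times> ?S. pair_entry (\<tau> \<omega>) p i = pair_entry \<omega> p i' \<and>
        (\<forall>q\<in>UNIV \<times> {..<d} - {p}. \<forall>l<d. pair_entry (\<tau> \<omega>) q l = pair_entry \<omega> q l))"
    if p: "p \<in> UNIV \<times> {..<d}" "i < d" "i' < d" for p i i'
  proof -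
    obtain \<tau> where \<tau>: "bij_betw \<tau> ?S ?S" "\<And>A. A \<in> ?S \<Longrightarrow> \<tau> A $$ (i, snd p) = A $$ (i', snd p)"
        "\<And>A l q. A \<in> ?S \<Longrightarrow> l < d \<Longrightarrow> q < d \<Longrightarrow> q \<noteq> snd p \<Longrightarrow> \<tau> A $$ (l, q) = A $$ (l, q)"
      using sparse_sign_mats_swap[of i d i' "snd p" r] p by force
    show ?thesis
      by (rule exI[of _ "?lift (fst p) \<tau>"], intro conjI lift \<tau>)
        (auto simp: pair_entry_def \<tau>(2,3) prod_eq_iff)
  qed
qed

section \<open>Moments of the norm error under the sparse distribution\<close>

lemma l2_norm_nonneg: "0 \<le> l2_norm v"
  by (simp add: l2_norm_def scalar_prod_def sum_nonneg)

lemma l2_norm_square: "v \<in> carrier_vec d \<Longrightarrow> (l2_norm v)\<^sup>2 = (\<Sum>i<d. (v $ i)\<^sup>2)"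
  by (auto simp: l2_norm_def scalar_prod_def sum_nonneg power2_eq_square lessThan_atLeast0)

lemma set_pmf_sparse_jl:
  assumes "1 \<le> r" "r \<le> d"
  shows "set_pmf (sparse_jl d r) = sparse_sign_mats d r \<times> sparse_sign_mats d r"
  unfolding sparse_jl_def using assms
  by (intro set_pmf_of_set) (auto simp: finite_sparse_sign_mats sparse_sign_mats_nonempty)

lemma expectation_sparse_jl:
  assumes "1 \<le> r" "r \<le> d"
  shows "measure_pmf.expectation (sparse_jl d r) f =
    (\<Sum>\<phi>\<in>sparse_sign_mats d r \<times> sparse_sign_mats d r. f \<phi>) /
      real (card (sparse_sign_mats d r \<times> sparse_sign_mats d r))"
  unfolding sparse_jl_def using assms
  by (intro integral_pmf_of_set) (auto simp: finite_sparse_sign_mats sparse_sign_mats_nonempty)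

definition norm_sq_error :: "pair_map \<Rightarrow> real vec \<Rightarrow> real vec \<Rightarrow> real" where
  "norm_sq_error \<phi> x y = (l2_norm (apply_map \<phi> x y))\<^sup>2 - ((l2_norm x)\<^sup>2 + (l2_norm y)\<^sup>2)"

text \<open>The pair acts as one matrix with \<open>2 * d\<close> columns on the concatenation
  \<open>v\<close> of \<open>x\<close> and \<open>y\<close>, so the error is the
  \<open>distortion\<close> of \<open>v\<close> over all columns.\<close>

lemma norm_sq_error_moments:
  assumes r: "1 \<le> r" "r \<le> d" and x: "x \<in> carrier_vec d" and y: "y \<in> carrier_vec d"
  shows "measure_pmf.expectation (sparse_jl d r) (\<lambda>\<phi>. norm_sq_error \<phi> x y) = 0"
    and "measure_pmf.expectation (sparse_jl d r) (\<lambda>\<phi>. (norm_sq_error \<phi> x y)\<^sup>2) \<le>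
      2 / real d * ((l2_norm x)\<^sup>2 + (l2_norm y)\<^sup>2)\<^sup>2"
proof -
  let ?\<Omega> = "sparse_sign_mats d r \<times> sparse_sign_mats d r"
  interpret symmetric_columns ?\<Omega> "UNIV \<times> {..<d}" d pair_entry
    by (rule symmetric_columns_sparse_pairs[OF r])
  define v where "v p = (if fst p then y $ snd p else x $ snd p)" for p
  have sum_P: "(\<Sum>p\<in>UNIV \<times> {..<d}. f p) = (\<Sum>j<d. f (False, j)) + (\<Sum>j<d. f (True, j))"
    for f :: "bool \<times> nat \<Rightarrow> real"
    using sum.cartesian_product[of "\<lambda>b j. f (b, j)" "{..<d}" UNIV] by (simp add: UNIV_bool)
  have N: "(\<Sum>p\<in>UNIV \<times> {..<d}. (v p)\<^sup>2) = (l2_norm x)\<^sup>2 + (l2_norm y)\<^sup>2"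
    using x y by (simp add: sum_P v_def l2_norm_square)
  have Z: "norm_sq_error \<phi> x y = distortion v (UNIV \<times> {..<d}) \<phi>" if "\<phi> \<in> ?\<Omega>" for \<phi>
  proof -
    have \<phi>: "fst \<phi> \<in> carrier_mat d d" "snd \<phi> \<in> carrier_mat d d"
      using that by (auto dest: sparse_sign_matsD(1))
    have "apply_map \<phi> x y $ i = image_coord v (UNIV \<times> {..<d}) \<phi> i" if "i < d" for i
      using \<phi> x y that
      by (simp add: apply_map_def image_coord_def sum_P v_def pair_entry_def scalar_prod_def
          atLeast0LessThan mult.commute)
    moreover have "apply_map \<phi> x y \<in> carrier_vec d"
      using \<phi> x y by (simp add: apply_map_def)
    ultimately show ?thesis
      by (simp add: norm_sq_error_def distortion_def N l2_norm_square)
  qed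
  have card: "real (card ?\<Omega>) > 0"
    using sparse_sign_mats_nonempty[OF r] finite_sparse_sign_mats by (simp add: card_gt_0_iff)
  show "measure_pmf.expectation (sparse_jl d r) (\<lambda>\<phi>. norm_sq_error \<phi> x y) = 0"
    using distortion_moments(1)[of "UNIV \<times> {..<d}" v] by (simp add: expectation_sparse_jl[OF r] Z)
  have "(\<Sum>\<phi>\<in>?\<Omega>. (norm_sq_error \<phi> x y)\<^sup>2) \<le> 2 / real d * ((l2_norm x)\<^sup>2 + (l2_norm y)\<^sup>2)\<^sup>2 * real (card ?\<Omega>)"
    using distortion_moments(2)[of "UNIV \<times> {..<d}" v] by (simp only: Z N order_refl cong: sum.cong)
  then show "measure_pmf.expectation (sparse_jl d r) (\<lambda>\<phi>. (norm_sq_error \<phi> x y)\<^sup>2) \<le>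
      2 / real d * ((l2_norm x)\<^sup>2 + (l2_norm y)\<^sup>2)\<^sup>2"
    unfolding expectation_sparse_jl[OF r] using card by (simp only: pos_divide_le_eq)
qed

text \<open>The error restricted to the failure event of the guarantee. Outside that event the error
  is at most \<epsilon> times the squared norm, so only this part has to be controlled in
  expectation.\<close>

definition bad_error :: "real \<Rightarrow> pair_map \<Rightarrow> real vec \<Rightarrow> real vec \<Rightarrow> real" where
  "bad_error \<epsilon> \<phi> x y =
    (if approx_within \<epsilon> ((l2_norm (apply_map \<phi> x y))\<^sup>2) ((l2_norm x)\<^sup>2 + (l2_norm y)\<^sup>2) then 0
     else \<bar>norm_sq_error \<phi> x y\<bar>)"

lemma bad_error_nonneg: "0 \<le> bad_error \<epsilon> \<phi> x y"
  by (simp add: bad_error_def)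

lemma abs_norm_sq_error_le:
  assumes "0 \<le> \<epsilon>"
  shows "\<bar>norm_sq_error \<phi> x y\<bar> \<le> \<epsilon> * ((l2_norm x)\<^sup>2 + (l2_norm y)\<^sup>2) + bad_error \<epsilon> \<phi> x y"
proof -
  have "0 \<le> \<epsilon> * ((l2_norm x)\<^sup>2 + (l2_norm y)\<^sup>2)"
    using assms by simp
  then show ?thesis
    by (auto simp: bad_error_def norm_sq_error_def approx_within_def algebra_simps)
qed

text \<open>Cauchy-Schwarz separates the second moment of the error from the probability of failure.
  The price is \<open>sqrt \<delta>\<close> in place of \<delta>; the gain is the factor
  \<open>sqrt (2 / real d)\<close>, which is of order \<epsilon> for the chosen dimension.\<close>

lemma expectation_bad_error_le:
  assumes r: "1 \<le> r" "r \<le> d" and x: "x \<in> carrier_vec d" and y: "y \<in> carrier_vec d"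
    and jl: "jl_guarantee (sparse_jl d r) d \<epsilon> \<delta>"
  shows "measure_pmf.expectation (sparse_jl d r) (\<lambda>\<phi>. bad_error \<epsilon> \<phi> x y) \<le>
    sqrt (2 / real d) * sqrt \<delta> * ((l2_norm x)\<^sup>2 + (l2_norm y)\<^sup>2)"
proof -
  let ?\<Omega> = "sparse_sign_mats d r \<times> sparse_sign_mats d r"
  let ?N = "(l2_norm x)\<^sup>2 + (l2_norm y)\<^sup>2"
  let ?E = "measure_pmf.expectation (sparse_jl d r)"
  define good where "good = {\<phi>. approx_within \<epsilon> ((l2_norm (apply_map \<phi> x y))\<^sup>2) ?N}"
  define b :: "pair_map \<Rightarrow> real" where "b \<phi> = indicator (- good) \<phi>" for \<phi>
  have bad: "bad_error \<epsilon> \<phi> x y = \<bar>norm_sq_error \<phi> x y\<bar> * b \<phi>" for \<phi>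
    by (auto simp: bad_error_def b_def good_def)
  have card: "real (card ?\<Omega>) > 0"
    using sparse_sign_mats_nonempty[OF r] finite_sparse_sign_mats by (simp add: card_gt_0_iff)
  have "(?E (\<lambda>\<phi>. bad_error \<epsilon> \<phi> x y))\<^sup>2 =
      (\<Sum>\<phi>\<in>?\<Omega>. \<bar>norm_sq_error \<phi> x y\<bar> * b \<phi>)\<^sup>2 / (real (card ?\<Omega>))\<^sup>2"
    by (simp only: expectation_sparse_jl[OF r] bad power_divide)
  also have "\<dots> \<le> ((\<Sum>\<phi>\<in>?\<Omega>. \<bar>norm_sq_error \<phi> x y\<bar>\<^sup>2) * (\<Sum>\<phi>\<in>?\<Omega>. (b \<phi>)\<^sup>2)) / (real (card ?\<Omega>))\<^sup>2"
    by (intro divide_right_mono Cauchy_Schwarz_ineq_sum) simp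
  also have "\<dots> = ?E (\<lambda>\<phi>. (norm_sq_error \<phi> x y)\<^sup>2) * ?E (\<lambda>\<phi>. (b \<phi>)\<^sup>2)"
    by (simp only: expectation_sparse_jl[OF r] power2_abs power2_eq_square[of "real _"] times_divide_times_eq)
  \<comment> \<open>An indicator equals its own square, so the second factor is the failure
    probability.\<close>
  also have "(\<lambda>\<phi>. (b \<phi>)\<^sup>2) = indicator (- good)"
    by (auto simp: b_def indicator_def)
  also have "?E (indicator (- good)) = 1 - measure_pmf.prob (sparse_jl d r) good"
    using measure_pmf.prob_compl[of good "sparse_jl d r"] by (simp add: Compl_eq_Diff_UNIV)
  also have "?E (\<lambda>\<phi>. (norm_sq_error \<phi> x y)\<^sup>2) * \<dots> \<le> (2 / real d * ?N\<^sup>2) * \<delta>"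
    using jl x y unfolding jl_guarantee_def good_def
    by (intro mult_mono norm_sq_error_moments r x y) (auto simp: algebra_simps)
  finally have "\<bar>?E (\<lambda>\<phi>. bad_error \<epsilon> \<phi> x y)\<bar> \<le> sqrt ((2 / real d * ?N\<^sup>2) * \<delta>)"
    using real_le_rsqrt by (metis real_sqrt_abs real_sqrt_le_mono)
  also have "\<dots> = sqrt (2 / real d) * sqrt \<delta> * ?N"
    by (simp only: real_sqrt_mult) simp
  finally show ?thesis by simp
qed

section \<open>Resampling one of the independent maps\<close>

text \<open>Overwriting component \<open>i\<close> by a fresh draw leaves the product distribution
  unchanged. The inner expectation then plays the role of a conditional expectation given all other
  components.\<close>

lemma expectation_Pi_pmf_resample:
  fixes f :: "('a \<Rightarrow> 'b) \<Rightarrow> real"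
  assumes "finite I" "i \<in> I" "finite (set_pmf F)"
  shows "measure_pmf.expectation (Pi_pmf I dflt (\<lambda>_. F)) f =
    measure_pmf.expectation (Pi_pmf I dflt (\<lambda>_. F)) (\<lambda>\<phi>. measure_pmf.expectation F (\<lambda>\<psi>. f (\<phi>(i := \<psi>))))"
proof -
  let ?P = "Pi_pmf I dflt (\<lambda>_. F)" and ?Q = "Pi_pmf (I - {i}) dflt (\<lambda>_. F)"
  have P: "?P = do {y \<leftarrow> F; g \<leftarrow> ?Q; return_pmf (g(i := y))}"
    using Pi_pmf_insert'[of "I - {i}" i dflt "\<lambda>_. F"] assms by (simp add: insert_absorb)
  have "?P \<bind> (\<lambda>\<phi>. map_pmf (\<lambda>\<psi>. \<phi>(i := \<psi>)) F) =
      do {_ \<leftarrow> F; g \<leftarrow> ?Q; \<psi> \<leftarrow> F; return_pmf (g(i := \<psi>))}"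
    by (simp add: P bind_assoc_pmf bind_return_pmf map_pmf_def)
  also have "\<dots> = ?P"
    by (subst bind_commute_pmf) (simp add: P bind_pmf_const bind_commute_pmf[of ?Q F])
  finally have resample: "?P \<bind> (\<lambda>\<phi>. map_pmf (\<lambda>\<psi>. \<phi>(i := \<psi>)) F) = ?P" .
  have fin: "finite (set_pmf ?P)"
    using assms by (simp add: set_Pi_pmf finite_PiE_dflt)
  have "measure_pmf.expectation ?P f =
      measure_pmf.expectation (?P \<bind> (\<lambda>\<phi>. map_pmf (\<lambda>\<psi>. \<phi>(i := \<psi>)) F)) f"
    by (simp only: resample)
  also have "\<dots> = (\<Sum>\<phi>\<in>set_pmf ?P. pmf ?P \<phi> *\<^sub>R measure_pmf.expectation (map_pmf (\<lambda>\<psi>. \<phi>(i := \<psi>)) F) f)"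
    using fin assms by (intro pmf_expectation_bind) auto
  also have "\<dots> = measure_pmf.expectation ?P (\<lambda>\<phi>. measure_pmf.expectation F (\<lambda>\<psi>. f (\<phi>(i := \<psi>))))"
    using fin by (subst integral_measure_pmf[of "set_pmf ?P"]) (auto simp: integral_map_pmf)
  finally show ?thesis .
qed

section \<open>The tree of sketch nodes: dependence on the maps, dimensions, linearity\<close>

text \<open>This makes the map of level \<open>Suc i\<close> fresh with respect to the nodes it is
  applied to: overwriting it does not change them.\<close>

lemma sketch_node_cong:
  "(\<And>l. 1 \<le> l \<Longrightarrow> l \<le> i \<Longrightarrow> \<phi> l = \<psi> l) \<Longrightarrow> sketch_node d \<phi> x i j = sketch_node d \<psi> x i j"
proof (induction i arbitrary: j)
  case (Suc i)
  have "sketch_node d \<phi> x i l = sketch_node d \<psi> x i l" for l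
    using Suc.prems by (intro Suc.IH) simp
  then show ?case using Suc.prems[of "Suc i"] by simp
qed simp

text \<open>The dimension of a sum of vectors is by definition that of its second summand, so the
  row count of \<open>snd \<phi>\<close> decides.\<close>

lemma apply_map_carrier:
  assumes "\<phi> \<in> carrier_mat d d \<times> carrier_mat d d"
  shows "apply_map \<phi> x y \<in> carrier_vec d"
proof -
  have "dim_row (snd \<phi>) = d" using assms by (auto simp: mem_Times_iff)
  then show ?thesis unfolding apply_map_def by (intro carrier_vecI) simp
qed

lemma sketch_node_carrier:
  assumes "\<And>l. 1 \<le> l \<Longrightarrow> l \<le> i \<Longrightarrow> \<phi> l \<in> carrier_mat d d \<times> carrier_mat d d"
  shows "sketch_node d \<phi> x i j \<in> carrier_vec d"
proof (cases i)
  case (Suc l)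
  then have "\<phi> (Suc l) \<in> carrier_mat d d \<times> carrier_mat d d" by (intro assms) simp_all
  then show ?thesis unfolding Suc sketch_node.simps by (rule apply_map_carrier)
qed simp

lemma block_index_less:
  fixes j s l d :: nat
  assumes "1 \<le> j" "j \<le> s" "l < d"
  shows "d * (j - 1) + l < d * s"
proof -
  have "d * (j - 1) + l < d * (j - 1) + d" using assms by simp
  also have "\<dots> = d * j" using assms(1) by (cases j) simp_all
  also have "\<dots> \<le> d * s" using assms(2) by (rule mult_le_mono2)
  finally show ?thesis .
qed

text \<open>Node \<open>j\<close> of level \<open>i\<close> covers input blocks up to number
  \<open>j * 2 ^ i\<close>. The invariant that this is at most \<open>s\<close> passes to both
  children and drives the inductions for linearity.\<close>

lemma child_index_bounds:
  fixes j s :: nat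
  assumes "1 \<le> j" "j * 2 ^ Suc i \<le> s"
  shows "1 \<le> 2 * j - 1 \<and> (2 * j - 1) * 2 ^ i \<le> s \<and> 1 \<le> 2 * j \<and> (2 * j) * 2 ^ i \<le> s"
proof -
  have le: "(2 * j) * 2 ^ i \<le> s" using assms(2) by (simp add: mult_ac)
  have "(2 * j - 1) * 2 ^ i \<le> (2 * j) * 2 ^ i"
    by (intro mult_le_mono diff_le_self order_refl)
  then have "(2 * j - 1) * 2 ^ i \<le> s" using le by (rule order_trans)
  moreover have "1 \<le> 2 * j - 1" "1 \<le> 2 * j" using assms(1) by linarith+
  ultimately show ?thesis using le by blast
qed

text \<open>The bounds on \<open>j\<close> keep all leaves below the node inside the input, where a
  coordinate of the sum is the sum of the coordinates.\<close>

lemma sketch_node_add: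
  assumes "\<And>l. 1 \<le> l \<Longrightarrow> l \<le> i \<Longrightarrow> \<phi> l \<in> carrier_mat d d \<times> carrier_mat d d"
    and "x \<in> carrier_vec (d * s)" "y \<in> carrier_vec (d * s)" "1 \<le> j" "j * 2 ^ i \<le> s"
  shows "sketch_node d \<phi> (x + y) i j = sketch_node d \<phi> x i j + sketch_node d \<phi> y i j"
  using assms(1,4,5)
proof (induction i arbitrary: j)
  case 0
  then show ?case using block_index_less[of j s _ d] assms(2,3) by (intro eq_vecI) auto
next
  case (Suc i)
  have j: "1 \<le> 2 * j - 1" "(2 * j - 1) * 2 ^ i \<le> s" "1 \<le> 2 * j" "(2 * j) * 2 ^ i \<le> s"
    using child_index_bounds[OF Suc.prems(2,3)] by blast+
  have c: "sketch_node d \<phi> z i l \<in> carrier_vec d" for z l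
    using Suc.prems(1) by (intro sketch_node_carrier) auto
  have \<phi>: "fst (\<phi> (Suc i)) \<in> carrier_mat d d" "snd (\<phi> (Suc i)) \<in> carrier_mat d d"
    using Suc.prems(1)[of "Suc i"] by auto
  have IH: "sketch_node d \<phi> (x + y) i l = sketch_node d \<phi> x i l + sketch_node d \<phi> y i l"
    if "1 \<le> l" "l * 2 ^ i \<le> s" for l
    using Suc.prems(1) that by (intro Suc.IH) auto
  have "apply_map (\<phi> (Suc i)) (u + u') (w + w') = apply_map (\<phi> (Suc i)) u w + apply_map (\<phi> (Suc i)) u' w'"
    if "u \<in> carrier_vec d" "u' \<in> carrier_vec d" "w \<in> carrier_vec d" "w' \<in> carrier_vec d" for u u' w w'
    unfolding apply_map_def mult_add_distrib_mat_vec[OF \<phi>(1) that(1,2)] mult_add_distrib_mat_vec[OF \<phi>(2) that(3,4)]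
    using \<phi> that by (intro eq_vecI) (auto simp: algebra_simps)
  then show ?case
    by (simp only: sketch_node.simps IH[OF j(1,2)] IH[OF j(3,4)] c)
qed

lemma sketch_node_smult:
  assumes "\<And>l. 1 \<le> l \<Longrightarrow> l \<le> i \<Longrightarrow> \<phi> l \<in> carrier_mat d d \<times> carrier_mat d d"
    and "x \<in> carrier_vec (d * s)" "1 \<le> j" "j * 2 ^ i \<le> s"
  shows "sketch_node d \<phi> (a \<cdot>\<^sub>v x) i j = a \<cdot>\<^sub>v sketch_node d \<phi> x i j"
  using assms(1,3,4)
proof (induction i arbitrary: j)
  case 0
  then show ?case using block_index_less[of j s _ d] assms(2) by (intro eq_vecI) auto
next
  case (Suc i)
  have j: "1 \<le> 2 * j - 1" "(2 * j - 1) * 2 ^ i \<le> s" "1 \<le> 2 * j" "(2 * j) * 2 ^ i \<le> s"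
    using child_index_bounds[OF Suc.prems(2,3)] by blast+
  have c: "sketch_node d \<phi> z i l \<in> carrier_vec d" for z l
    using Suc.prems(1) by (intro sketch_node_carrier) auto
  have \<phi>: "fst (\<phi> (Suc i)) \<in> carrier_mat d d" "snd (\<phi> (Suc i)) \<in> carrier_mat d d"
    using Suc.prems(1)[of "Suc i"] by auto
  have IH: "sketch_node d \<phi> (a \<cdot>\<^sub>v x) i l = a \<cdot>\<^sub>v sketch_node d \<phi> x i l"
    if "1 \<le> l" "l * 2 ^ i \<le> s" for l
    using Suc.prems(1) that by (intro Suc.IH) auto
  have "apply_map (\<phi> (Suc i)) (a \<cdot>\<^sub>v u) (a \<cdot>\<^sub>v w) = a \<cdot>\<^sub>v apply_map (\<phi> (Suc i)) u w"
    if "u \<in> carrier_vec d" "w \<in> carrier_vec d" for u w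
    unfolding apply_map_def mult_mat_vec[OF \<phi>(1) that(1)] mult_mat_vec[OF \<phi>(2) that(2)]
    using \<phi> that by (intro eq_vecI) (auto simp: algebra_simps)
  then show ?case
    by (simp only: sketch_node.simps IH[OF j(1,2)] IH[OF j(3,4)] c)
qed

lemma linear_single_sketch:
  assumes "\<And>l. 1 \<le> l \<Longrightarrow> l \<le> k \<Longrightarrow> \<phi> l \<in> carrier_mat d d \<times> carrier_mat d d"
  shows "linear_on_vecs (d * 2 ^ k) d (single_sketch d k \<phi>)"
  unfolding linear_on_vecs_def single_sketch_def
  using sketch_node_carrier[OF assms] sketch_node_add[OF assms] sketch_node_smult[OF assms] by auto

section \<open>Error propagation through the levels\<close>

text \<open>Two passes. The crude bound \<open>S i \<le> 3 * (1 + M) * S 0\<close> follows from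
  \<open>(1 + \<epsilon>) ^ i \<le> exp 1 \<le> 3\<close>. Inserted into every step, it makes the
  increments add up linearly, so that the drift is proportional to
  \<open>real k * \<epsilon>\<close>. In the constant, \<open>3 * (1 + M)\<close> comes from the
  relative errors and \<open>M\<close> from the total of \<open>B\<close>.\<close>

lemma discrete_gronwall:
  fixes S B :: "nat \<Rightarrow> real"
  assumes step: "\<And>i. i < k \<Longrightarrow> \<bar>S (Suc i) - S i\<bar> \<le> \<epsilon> * S i + B i"
    and B: "\<And>i. 0 \<le> B i" "(\<Sum>i<k. B i) \<le> M * (real k * \<epsilon>) * S 0"
    and "0 \<le> \<epsilon>" "real k * \<epsilon> \<le> 1" "0 \<le> M" "0 \<le> S 0"
  shows "\<bar>S k - S 0\<bar> \<le> (3 * (1 + M) + M) * (real k * \<epsilon>) * S 0"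
proof -
  \<comment> \<open>For the crude bound the factor \<open>real k * \<epsilon>\<close> is simply
    estimated by 1.\<close>
  have sum_le: "(\<Sum>l<i. B l) \<le> M * S 0" if "i \<le> k" for i
  proof -
    have "(\<Sum>l<i. B l) \<le> (\<Sum>l<k. B l)" using that B(1) by (intro sum_mono2) auto
    also have "\<dots> \<le> M * (real k * \<epsilon>) * S 0" by (rule B(2))
    also have "\<dots> \<le> M * 1 * S 0" using assms by (intro mult_mono) auto
    finally show ?thesis by simp
  qed
  have growth: "S i \<le> (1 + \<epsilon>) ^ i * (S 0 + (\<Sum>l<i. B l))" if "i \<le> k" for i
    using that
  proof (induction i)
    case (Suc i)
    have "S (Suc i) \<le> (1 + \<epsilon>) * S i + B i"
      using step[of i] Suc by (simp add: algebra_simps)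
    \<comment> \<open>Inflating \<open>B i\<close> by a factor of at least 1 gives all terms the
      common factor \<open>(1 + \<epsilon>) ^ Suc i\<close>.\<close>
    also have "\<dots> \<le> (1 + \<epsilon>) * ((1 + \<epsilon>) ^ i * (S 0 + (\<Sum>l<i. B l))) + (1 + \<epsilon>) ^ Suc i * B i"
    proof (intro add_mono mult_left_mono)
      show "B i \<le> (1 + \<epsilon>) ^ Suc i * B i"
        using mult_right_mono[OF one_le_power[of "1 + \<epsilon>" "Suc i"] B(1)[of i]] \<open>0 \<le> \<epsilon>\<close> by simp
    qed (use Suc \<open>0 \<le> \<epsilon>\<close> in auto)
    also have "\<dots> = (1 + \<epsilon>) ^ Suc i * (S 0 + (\<Sum>l<Suc i. B l))"
      by (simp add: algebra_simps)
    finally show ?case .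
  qed simp
  have bound: "S i \<le> 3 * (1 + M) * S 0" if "i \<le> k" for i
  proof -
    have "(1 + \<epsilon>) ^ i \<le> exp \<epsilon> ^ i"
      using \<open>0 \<le> \<epsilon>\<close> by (intro power_mono) auto
    also have "\<dots> = exp (real i * \<epsilon>)" by (simp add: exp_of_nat_mult)
    also have "\<dots> \<le> exp 1"
    proof -
      have "real i * \<epsilon> \<le> real k * \<epsilon>" using that \<open>0 \<le> \<epsilon>\<close> by (intro mult_right_mono) auto
      then show ?thesis using \<open>real k * \<epsilon> \<le> 1\<close> by simp
    qed
    also have "\<dots> \<le> 3" by (rule exp_le)
    finally have e: "(1 + \<epsilon>) ^ i \<le> 3" .
    have "S i \<le> (1 + \<epsilon>) ^ i * (S 0 + (\<Sum>l<i. B l))" by (rule growth[OF that])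
    also have "\<dots> \<le> 3 * (S 0 + M * S 0)"
      using e sum_le[OF that] \<open>0 \<le> S 0\<close> B(1) by (intro mult_mono add_mono) (auto intro: sum_nonneg add_nonneg_nonneg)
    finally show ?thesis by (simp add: algebra_simps)
  qed
  have drift: "\<bar>S i - S 0\<bar> \<le> real i * (\<epsilon> * (3 * (1 + M) * S 0)) + (\<Sum>l<i. B l)" if "i \<le> k" for i
    using that
  proof (induction i)
    case (Suc i)
    have "\<bar>S (Suc i) - S 0\<bar> \<le> \<bar>S (Suc i) - S i\<bar> + \<bar>S i - S 0\<bar>" by simp
    also have "\<dots> \<le> (\<epsilon> * (3 * (1 + M) * S 0) + B i) + (real i * (\<epsilon> * (3 * (1 + M) * S 0)) + (\<Sum>l<i. B l))"
    proof (rule add_mono)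
      have "\<epsilon> * S i \<le> \<epsilon> * (3 * (1 + M) * S 0)"
        using Suc.prems \<open>0 \<le> \<epsilon>\<close> by (intro mult_left_mono bound) auto
      then show "\<bar>S (Suc i) - S i\<bar> \<le> \<epsilon> * (3 * (1 + M) * S 0) + B i"
        using step[of i] Suc.prems by linarith
    qed (use Suc in simp)
    also have "\<dots> = real (Suc i) * (\<epsilon> * (3 * (1 + M) * S 0)) + (\<Sum>l<Suc i. B l)"
      by (simp add: algebra_simps)
    finally show ?case .
  qed simp
  have "\<bar>S k - S 0\<bar> \<le> real k * (\<epsilon> * (3 * (1 + M) * S 0)) + M * (real k * \<epsilon>) * S 0"
    using drift[of k] B(2) by linarith
  then show ?thesis by (simp add: algebra_simps)
qed

text \<open>Since \<open>a + b \<ge> b\<close>, the factorisation of the difference of squares shows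
  that taking roots does not enlarge the relative error.\<close>

lemma approx_within_of_square:
  assumes "\<bar>a\<^sup>2 - b\<^sup>2\<bar> \<le> \<delta> * b\<^sup>2" "0 \<le> a" "0 < b"
  shows "approx_within \<delta> a b"
proof -
  have "\<bar>a - b\<bar> * b \<le> \<bar>a - b\<bar> * (a + b)"
    using assms by (intro mult_left_mono) auto
  also have "\<dots> = \<bar>a\<^sup>2 - b\<^sup>2\<bar>"
    using assms by (simp add: power2_eq_square square_diff_square_factored abs_mult mult.commute)
  also have "\<dots> \<le> (\<delta> * b) * b"
    using assms(1) by (simp add: power2_eq_square mult.assoc)
  finally have "\<bar>a - b\<bar> \<le> \<delta> * b"
    using assms(3) by simp
  then show ?thesis by (auto simp: approx_within_def algebra_simps)
qed

section \<open>Energy and error of a level\<close>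

lemma sum_odd_even:
  fixes f :: "nat \<Rightarrow> real"
  shows "(\<Sum>j=1..N. f (2 * j - 1) + f (2 * j)) = (\<Sum>j=1..2 * N. f j)"
  by (induction N) (auto simp: algebra_simps)

text \<open>This is \<open>S\<^sub>i\<close> of the overview; level \<open>i\<close> has
  \<open>2 ^ (k - i)\<close> nodes.\<close>

definition level_energy :: "nat \<Rightarrow> nat \<Rightarrow> (nat \<Rightarrow> pair_map) \<Rightarrow> real vec \<Rightarrow> nat \<Rightarrow> real" where
  "level_energy d k \<phi> x i = (\<Sum>j=1..2 ^ (k - i). (l2_norm (sketch_node d \<phi> x i j))\<^sup>2)"

text \<open>This is \<open>B\<^sub>i\<close> of the overview. It sums over the sibling pairs of
  level \<open>i\<close>, hence the exponent \<open>k - Suc i\<close>.\<close>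

definition level_bad_error :: "nat \<Rightarrow> nat \<Rightarrow> real \<Rightarrow> (nat \<Rightarrow> pair_map) \<Rightarrow> real vec \<Rightarrow> nat \<Rightarrow> real" where
  "level_bad_error d k \<epsilon> \<phi> x i = (\<Sum>j=1..2 ^ (k - Suc i).
    bad_error \<epsilon> (\<phi> (Suc i)) (sketch_node d \<phi> x i (2 * j - 1)) (sketch_node d \<phi> x i (2 * j)))"

lemma level_energy_nonneg: "0 \<le> level_energy d k \<phi> x i"
  by (simp add: level_energy_def sum_nonneg)

lemma level_bad_error_nonneg: "0 \<le> level_bad_error d k \<epsilon> \<phi> x i"
  by (simp add: level_bad_error_def sum_nonneg bad_error_nonneg)

lemma level_energy_pairs:
  assumes "i < k"
  shows "level_energy d k \<phi> x i = (\<Sum>j=1..2 ^ (k - Suc i).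
    (l2_norm (sketch_node d \<phi> x i (2 * j - 1)))\<^sup>2 + (l2_norm (sketch_node d \<phi> x i (2 * j)))\<^sup>2)"
proof -
  have "k - i = Suc (k - Suc i)" using assms by simp
  then show ?thesis
    unfolding level_energy_def
    using sum_odd_even[of "\<lambda>j. (l2_norm (sketch_node d \<phi> x i j))\<^sup>2" "2 ^ (k - Suc i)"] by simp
qed

lemma level_energy_Suc:
  assumes "i < k"
  shows "level_energy d k \<phi> x (Suc i) = level_energy d k \<phi> x i + (\<Sum>j=1..2 ^ (k - Suc i).
    norm_sq_error (\<phi> (Suc i)) (sketch_node d \<phi> x i (2 * j - 1)) (sketch_node d \<phi> x i (2 * j)))"
  unfolding level_energy_pairs[OF assms] sum.distrib[symmetric]
  by (simp add: level_energy_def norm_sq_error_def)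

text \<open>The triangle inequality over the sibling pairs yields the recurrence required by
  \<open>discrete_gronwall\<close>.\<close>

lemma level_energy_step:
  assumes "i < k" "0 \<le> \<epsilon>"
  shows "\<bar>level_energy d k \<phi> x (Suc i) - level_energy d k \<phi> x i\<bar> \<le>
    \<epsilon> * level_energy d k \<phi> x i + level_bad_error d k \<epsilon> \<phi> x i"
proof -
  let ?u = "\<lambda>j. sketch_node d \<phi> x i (2 * j - 1)" and ?v = "\<lambda>j. sketch_node d \<phi> x i (2 * j)"
  have "\<bar>level_energy d k \<phi> x (Suc i) - level_energy d k \<phi> x i\<bar> \<le>
      (\<Sum>j=1..2 ^ (k - Suc i). \<bar>norm_sq_error (\<phi> (Suc i)) (?u j) (?v j)\<bar>)"
    by (simp only: level_energy_Suc[OF assms(1)] add_diff_cancel_left' sum_abs)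
  also have "\<dots> \<le> (\<Sum>j=1..2 ^ (k - Suc i). \<epsilon> * ((l2_norm (?u j))\<^sup>2 + (l2_norm (?v j))\<^sup>2) +
      bad_error \<epsilon> (\<phi> (Suc i)) (?u j) (?v j))"
    by (intro sum_mono abs_norm_sq_error_le assms)
  also have "\<dots> = \<epsilon> * level_energy d k \<phi> x i + level_bad_error d k \<epsilon> \<phi> x i"
    unfolding level_energy_pairs[OF assms(1)] level_bad_error_def sum_distrib_left by (rule sum.distrib)
  finally show ?thesis .
qed

lemma level_energy_0:
  assumes "x \<in> carrier_vec (d * 2 ^ k)"
  shows "level_energy d k \<phi> x 0 = (l2_norm x)\<^sup>2"
proof -
  have block: "(l2_norm (sketch_node d \<phi> x 0 (Suc j)))\<^sup>2 = (\<Sum>i\<in>{j * d..<j * d + d}. (x $ i)\<^sup>2)" for j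
  proof -
    have "(l2_norm (sketch_node d \<phi> x 0 (Suc j)))\<^sup>2 = (\<Sum>l<d. (x $ (d * j + l))\<^sup>2)"
      by (subst l2_norm_square[of _ d]) simp_all
    also have "\<dots> = (\<Sum>i\<in>{j * d..<j * d + d}. (x $ i)\<^sup>2)"
      by (rule sum.reindex_bij_witness[of _ "\<lambda>i. i - d * j" "\<lambda>l. d * j + l"]) (auto simp: mult.commute)
    finally show ?thesis .
  qed
  have "level_energy d k \<phi> x 0 = (\<Sum>j<2 ^ k. (l2_norm (sketch_node d \<phi> x 0 (Suc j)))\<^sup>2)"
    unfolding level_energy_def
    by (rule sum.reindex_bij_witness[of _ Suc "\<lambda>j. j - 1"]) auto
  also have "\<dots> = (\<Sum>i<2 ^ k * d. (x $ i)\<^sup>2)"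
    unfolding block by (rule sum.nat_group)
  also have "\<dots> = (l2_norm x)\<^sup>2"
    using assms by (simp add: l2_norm_square mult.commute)
  finally show ?thesis .
qed

section \<open>Concentration of the sketch norm for an unbiased random map\<close>

text \<open>Finite support makes every real function of the maps integrable, and
  \<open>mean_error\<close> keeps the expected energy constant along the levels.\<close>

locale unbiased_pair_map =
  fixes F :: "pair_map pmf" and d :: nat
  assumes finite_support: "finite (set_pmf F)"
    and support: "set_pmf F \<subseteq> carrier_mat d d \<times> carrier_mat d d"
    and mean_error: "x \<in> carrier_vec d \<Longrightarrow> y \<in> carrier_vec d \<Longrightarrow>
      measure_pmf.expectation F (\<lambda>\<phi>. norm_sq_error \<phi> x y) = 0"
begin

lemma set_independent_maps:
  assumes "\<phi> \<in> set_pmf (independent_maps k F)" "1 \<le> l" "l \<le> k"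
  shows "\<phi> l \<in> set_pmf F"
  using assms by (auto simp: independent_maps_def set_Pi_pmf PiE_dflt_def)

lemma independent_maps_carrier:
  assumes "\<phi> \<in> set_pmf (independent_maps k F)" "1 \<le> l" "l \<le> k"
  shows "\<phi> l \<in> carrier_mat d d \<times> carrier_mat d d"
  using set_independent_maps[OF assms] support by blast

lemma integrable_independent_maps:
  "integrable (measure_pmf (independent_maps k F)) (f :: _ \<Rightarrow> real)"
  unfolding independent_maps_def
  by (intro integrable_measure_pmf_finite) (simp add: set_Pi_pmf finite_PiE_dflt finite_support)

text \<open>The nodes of level \<open>i\<close> depend on earlier maps only, so the map
  \<open>Suc i\<close> can be averaged while they are held fixed. All pairs of a level share this
  map, but linearity of expectation asks for no independence between pairs.\<close>

lemma expectation_level: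
  fixes h :: "pair_map \<Rightarrow> real vec \<Rightarrow> real vec \<Rightarrow> real"
  assumes "i < k"
  shows "measure_pmf.expectation (independent_maps k F) (\<lambda>\<phi>. \<Sum>j=1..N.
      h (\<phi> (Suc i)) (sketch_node d \<phi> x i (2 * j - 1)) (sketch_node d \<phi> x i (2 * j))) =
    measure_pmf.expectation (independent_maps k F) (\<lambda>\<phi>. \<Sum>j=1..N.
      measure_pmf.expectation F (\<lambda>\<psi>. h \<psi> (sketch_node d \<phi> x i (2 * j - 1)) (sketch_node d \<phi> x i (2 * j))))"
proof -
  have upd: "sketch_node d (\<phi>(Suc i := \<psi>)) x i j = sketch_node d \<phi> x i j" for \<phi> \<psi> j
    by (rule sketch_node_cong) simp
  show ?thesis
    unfolding independent_maps_def
    by (subst expectation_Pi_pmf_resample[of _ "Suc i"])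
      (use assms in \<open>simp_all add: finite_support upd integrable_measure_pmf_finite\<close>)
qed

text \<open>Given the earlier maps, the error added by each level has mean 0, so the expectation
  never moves from its value at the leaves.\<close>

lemma expectation_level_energy:
  assumes "x \<in> carrier_vec (d * 2 ^ k)" "i \<le> k"
  shows "measure_pmf.expectation (independent_maps k F) (\<lambda>\<phi>. level_energy d k \<phi> x i) = (l2_norm x)\<^sup>2"
  using assms(2)
proof (induction i)
  case 0
  then show ?case by (simp add: level_energy_0[OF assms(1)])
next
  case (Suc i)
  let ?E = "measure_pmf.expectation (independent_maps k F)"
  have "?E (\<lambda>\<phi>. level_energy d k \<phi> x (Suc i)) = ?E (\<lambda>\<phi>. level_energy d k \<phi> x i) +
      ?E (\<lambda>\<phi>. \<Sum>j=1..2 ^ (k - Suc i). norm_sq_error (\<phi> (Suc i)) (sketch_node d \<phi> x i (2 * j - 1))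
        (sketch_node d \<phi> x i (2 * j)))"
    using Suc.prems
    by (subst level_energy_Suc) (simp, intro Bochner_Integration.integral_add integrable_independent_maps)
  also have "?E (\<lambda>\<phi>. \<Sum>j=1..2 ^ (k - Suc i). norm_sq_error (\<phi> (Suc i)) (sketch_node d \<phi> x i (2 * j - 1))
        (sketch_node d \<phi> x i (2 * j))) = ?E (\<lambda>\<phi>. 0)"
    unfolding expectation_level[OF Suc_le_lessD[OF Suc.prems]]
  proof (intro integral_cong_AE)
    show "AE \<phi> in measure_pmf (independent_maps k F). (\<Sum>j=1..2 ^ (k - Suc i). measure_pmf.expectation F
        (\<lambda>\<psi>. norm_sq_error \<psi> (sketch_node d \<phi> x i (2 * j - 1)) (sketch_node d \<phi> x i (2 * j)))) = 0"
    proof (rule AE_pmfI)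
      fix \<phi> assume \<phi>: "\<phi> \<in> set_pmf (independent_maps k F)"
      have "sketch_node d \<phi> x i j \<in> carrier_vec d" for j
        using Suc.prems by (intro sketch_node_carrier independent_maps_carrier[OF \<phi>]) simp_all
      then show "(\<Sum>j=1..2 ^ (k - Suc i). measure_pmf.expectation F
        (\<lambda>\<psi>. norm_sq_error \<psi> (sketch_node d \<phi> x i (2 * j - 1)) (sketch_node d \<phi> x i (2 * j)))) = 0"
        by (intro sum.neutral ballI mean_error)
    qed
  qed simp_all
  finally show ?case using Suc by simp
qed

text \<open>Averaging the fresh map first leaves \<eta> times the energy of level \<open>i\<close>.
  As its expectation equals \<open>(l2_norm x)\<^sup>2\<close> on every level, no growth factor
  enters.\<close>

lemma expectation_level_bad_error_le:
  assumes "x \<in> carrier_vec (d * 2 ^ k)" "i < k"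
    and bad: "\<And>x y. x \<in> carrier_vec d \<Longrightarrow> y \<in> carrier_vec d \<Longrightarrow>
      measure_pmf.expectation F (\<lambda>\<phi>. bad_error \<epsilon> \<phi> x y) \<le> \<eta> * ((l2_norm x)\<^sup>2 + (l2_norm y)\<^sup>2)"
  shows "measure_pmf.expectation (independent_maps k F) (\<lambda>\<phi>. level_bad_error d k \<epsilon> \<phi> x i) \<le> \<eta> * (l2_norm x)\<^sup>2"
proof -
  let ?E = "measure_pmf.expectation (independent_maps k F)"
  have "?E (\<lambda>\<phi>. level_bad_error d k \<epsilon> \<phi> x i) \<le> ?E (\<lambda>\<phi>. \<eta> * level_energy d k \<phi> x i)"
    unfolding level_bad_error_def expectation_level[OF assms(2)]
  proof (intro integral_mono_AE integrable_independent_maps AE_pmfI)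
    fix \<phi> assume \<phi>: "\<phi> \<in> set_pmf (independent_maps k F)"
    have "sketch_node d \<phi> x i j \<in> carrier_vec d" for j
      using assms by (intro sketch_node_carrier independent_maps_carrier[OF \<phi>]) simp_all
    then show "(\<Sum>j=1..2 ^ (k - Suc i). measure_pmf.expectation F
        (\<lambda>\<psi>. bad_error \<epsilon> \<psi> (sketch_node d \<phi> x i (2 * j - 1)) (sketch_node d \<phi> x i (2 * j)))) \<le>
      \<eta> * level_energy d k \<phi> x i"
      unfolding level_energy_pairs[OF assms(2)] sum_distrib_left by (intro sum_mono bad)
  qed
  also have "\<dots> = \<eta> * (l2_norm x)\<^sup>2"
    using expectation_level_energy[OF assms(1), of i] assms(2) by simp
  finally show ?thesis .
qed

text \<open>Markov's inequality is applied to the total bad error \<open>?B\<close> with threshold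
  \<open>?a\<close>. The same \<open>M\<close> scales both the mean and the threshold, so their
  ratio is at most \<delta>. Below the threshold the Gronwall bound holds deterministically.\<close>

lemma single_sketch_concentration:
  assumes x: "x \<in> carrier_vec (d * 2 ^ k)" and \<epsilon>: "0 < \<epsilon>" "real k * \<epsilon> \<le> 1" and "0 < M" "0 \<le> \<delta>"
    and bad: "\<And>x y. x \<in> carrier_vec d \<Longrightarrow> y \<in> carrier_vec d \<Longrightarrow>
      measure_pmf.expectation F (\<lambda>\<phi>. bad_error \<epsilon> \<phi> x y) \<le> M * \<epsilon> * \<delta> * ((l2_norm x)\<^sup>2 + (l2_norm y)\<^sup>2)"
  shows "measure_pmf.prob (independent_maps k F)
    {\<phi>. approx_within ((3 * (1 + M) + M) * (real k * \<epsilon>)) (l2_norm (single_sketch d k \<phi> x)) (l2_norm x)} \<ge> 1 - \<delta>"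
    (is "measure_pmf.prob ?P ?G \<ge> _")
proof -
  let ?B = "\<lambda>\<phi>. \<Sum>i<k. level_bad_error d k \<epsilon> \<phi> x i"
  let ?a = "M * (real k * \<epsilon>) * (l2_norm x)\<^sup>2"
  have good: "\<phi> \<in> ?G" if "l2_norm x > 0" "?B \<phi> \<le> ?a" for \<phi>
  proof -
    have "\<bar>level_energy d k \<phi> x k - level_energy d k \<phi> x 0\<bar> \<le>
        (3 * (1 + M) + M) * (real k * \<epsilon>) * level_energy d k \<phi> x 0"
      using that \<epsilon> \<open>0 < M\<close>
      by (intro discrete_gronwall[where B = "level_bad_error d k \<epsilon> \<phi> x"] level_energy_step
          level_bad_error_nonneg level_energy_nonneg) (simp_all add: level_energy_0[OF x])
    then show ?thesis
      using that by (simp add: approx_within_of_square l2_norm_nonneg level_energy_0[OF x]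
          level_energy_def[of d k \<phi> x k] single_sketch_def)
  qed
  \<comment> \<open>Markov's inequality needs a positive threshold \<open>?a\<close>, which excludes
    \<open>l2_norm x = 0\<close> and \<open>k = 0\<close>.\<close>
  consider (zero) "l2_norm x = 0" | (k0) "l2_norm x > 0" "k = 0" | (pos) "l2_norm x > 0" "k > 0"
    using l2_norm_nonneg[of x] by force
  then show ?thesis
  proof cases
    case zero
    have "(\<Sum>i<d * 2 ^ k. (x $ i)\<^sup>2) = 0"
      using zero l2_norm_square[OF x] by simp
    then have "x $ i = 0" if "i < d * 2 ^ k" for i
      using that by (simp add: sum_nonneg_eq_0_iff)
    \<comment> \<open>Writing \<open>x\<close> as a multiple by 0 lets linearity force the sketch to
      have norm 0.\<close>
    then have x0: "x = 0 \<cdot>\<^sub>v x" using x by (intro eq_vecI) auto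
    have "\<phi> \<in> ?G" if "\<phi> \<in> set_pmf ?P" for \<phi>
    proof -
      have "linear_on_vecs (d * 2 ^ k) d (single_sketch d k \<phi>)"
        by (intro linear_single_sketch independent_maps_carrier[OF that])
      then have "single_sketch d k \<phi> x = 0 \<cdot>\<^sub>v single_sketch d k \<phi> x"
        using x x0 unfolding linear_on_vecs_def by metis
      then have "l2_norm (single_sketch d k \<phi> x) = l2_norm (0 \<cdot>\<^sub>v single_sketch d k \<phi> x)" by (rule arg_cong)
      also have "\<dots> = 0" by (simp add: l2_norm_def scalar_prod_def)
      finally show ?thesis by (simp add: zero approx_within_def)
    qed
    then have "measure_pmf.prob ?P ?G = 1"
      by (intro measure_pmf.prob_eq_1[THEN iffD2]) (auto intro: AE_pmfI)
    then show ?thesis using \<open>0 \<le> \<delta>\<close> by linarith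
  next
    case k0
    \<comment> \<open>With no levels, the total and the threshold are both 0, so every outcome is
      good.\<close>
    then have "?G = UNIV" using good by auto
    then show ?thesis using \<open>0 \<le> \<delta>\<close> by simp
  next
    case pos
    have a: "?a > 0" using pos \<epsilon> \<open>0 < M\<close> by simp
    have "measure_pmf.expectation ?P ?B = (\<Sum>i<k. measure_pmf.expectation ?P (\<lambda>\<phi>. level_bad_error d k \<epsilon> \<phi> x i))"
      by (intro Bochner_Integration.integral_sum integrable_independent_maps)
    also have "\<dots> \<le> (\<Sum>i<k. M * \<epsilon> * \<delta> * (l2_norm x)\<^sup>2)"
      using bad by (intro sum_mono expectation_level_bad_error_le x) auto
    also have "\<dots> = ?a * \<delta>" by simp
    finally have EB: "measure_pmf.expectation ?P ?B \<le> ?a * \<delta>" .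
    have "measure_pmf.prob ?P {\<phi>. ?B \<phi> \<ge> ?a} \<le> measure_pmf.expectation ?P ?B / ?a"
      using integral_Markov_inequality_measure[OF integrable_independent_maps[of k ?B], of UNIV ?a] a
      by (simp add: sum_nonneg level_bad_error_nonneg)
    also have "\<dots> \<le> \<delta>" using EB a by (simp only: pos_divide_le_eq mult.commute)
    finally have markov: "measure_pmf.prob ?P {\<phi>. ?B \<phi> \<ge> ?a} \<le> \<delta>" .
    have "1 - \<delta> \<le> 1 - measure_pmf.prob ?P {\<phi>. ?B \<phi> \<ge> ?a}" using markov by simp
    also have "\<dots> = measure_pmf.prob ?P (- {\<phi>. ?B \<phi> \<ge> ?a})"
      using measure_pmf.prob_compl[of "{\<phi>. ?B \<phi> \<ge> ?a}" ?P] by (simp add: Compl_eq_Diff_UNIV)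
    also have "\<dots> \<le> measure_pmf.prob ?P ?G"
    proof (rule measure_pmf.finite_measure_mono)
      show "- {\<phi>. ?B \<phi> \<ge> ?a} \<subseteq> ?G"
        using good[OF pos(1)] by (force simp del: mem_Collect_eq simp: not_le Compl_iff)
    qed simp
    finally show ?thesis .
  qed
qed

end

section \<open>Correctness and running time of the implementation\<close>

text \<open>A form of the recursion with projections in place of tuple patterns, so that result and
  time can be rewritten separately.\<close>

lemma add_scaled_col_Cons:
  "add_scaled_col (e # es) c w =
    (let R = add_scaled_col es c (w[fst e := w ! fst e + snd e * c]) in (fst R, snd R + 2))"
  by (cases e) (simp add: Let_def case_prod_beta)

lemma length_add_scaled_col: "length (fst (add_scaled_col es c w)) = length w"
  by (induction es arbitrary: w) (simp_all add: add_scaled_col_Cons Let_def)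

lemma time_add_scaled_col: "snd (add_scaled_col es c w) = 2 * length es + 1"
  by (induction es arbitrary: w) (simp_all add: add_scaled_col_Cons Let_def)

lemma nth_add_scaled_col:
  assumes "\<forall>e\<in>set es. fst e < length w" "l < length w"
  shows "fst (add_scaled_col es c w) ! l = w ! l + (\<Sum>e\<leftarrow>es. if fst e = l then snd e * c else 0)"
  using assms
  by (induction es arbitrary: w)
    (simp_all add: add_scaled_col_Cons Let_def nth_list_update)

lemma length_add_mult: "length (fst (add_mult B x w)) = length w"
  by (induction B x arbitrary: w rule: list_induct2') (simp_all add: Let_def case_prod_beta length_add_scaled_col)

lemma time_add_mult:
  "length B = length x \<Longrightarrow> snd (add_mult B x w) = (\<Sum>es\<leftarrow>B. 2 * length es + 2) + 1"
  by (induction B x arbitrary: w rule: list_induct2') (simp_all add: Let_def case_prod_beta time_add_scaled_col)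

lemma nth_add_mult:
  assumes "\<forall>es\<in>set B. \<forall>e\<in>set es. fst e < length w" "l < length w" "length B = length x"
  shows "fst (add_mult B x w) ! l =
    w ! l + (\<Sum>p\<leftarrow>zip B x. \<Sum>e\<leftarrow>fst p. if fst e = l then snd e * snd p else 0)"
  using assms
  by (induction B x arbitrary: w rule: list_induct2')
    (simp_all add: Let_def case_prod_beta length_add_scaled_col nth_add_scaled_col cong: if_cong)

lemma length_sparse_cols_of: "length (sparse_cols_of A) = dim_col A"
  by (simp add: sparse_cols_of_def)

text \<open>Row \<open>l\<close> occurs at most once in the stored column, and it is missing only if
  the entry is 0, in which case the empty sum is right as well.\<close>

lemma sum_sparse_col:
  assumes "A \<in> carrier_mat d d" "l < d" "j < d"
  shows "(\<Sum>e\<leftarrow>sparse_cols_of A ! j. if fst e = l then snd e * c else 0) = A $$ (l, j) * c"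
proof -
  have "(\<Sum>e\<leftarrow>sparse_cols_of A ! j. if fst e = l then snd e * c else 0) =
      (\<Sum>i\<leftarrow>filter (\<lambda>i. A $$ (i, j) \<noteq> 0) [0..<d]. if i = l then A $$ (i, j) * c else 0)"
    using assms by (simp add: sparse_cols_of_def comp_def cong: if_cong)
  also have "\<dots> = (\<Sum>i\<in>set (filter (\<lambda>i. A $$ (i, j) \<noteq> 0) [0..<d]). if i = l then A $$ (i, j) * c else 0)"
    by (rule sum_list_distinct_conv_sum_set) simp
  also have "\<dots> = A $$ (l, j) * c"
    using assms by (simp add: sum.delta)
  finally show ?thesis .
qed

text \<open>The accumulation runs column by column; coordinate \<open>l\<close> of the result
  collects \<open>A $$ (l, j) * x $ j\<close> over all \<open>j\<close>, which is the row-wise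
  product.\<close>

lemma add_mult_sparse_cols:
  assumes A: "A \<in> carrier_mat d d" and x: "x \<in> carrier_vec d" and w: "length w = d"
  shows "fst (add_mult (sparse_cols_of A) (list_of_vec x) w) = list_of_vec (vec_of_list w + A *\<^sub>v x)"
proof (rule nth_equalityI)
  show "length (fst (add_mult (sparse_cols_of A) (list_of_vec x) w)) = length (list_of_vec (vec_of_list w + A *\<^sub>v x))"
    using A w by (simp add: length_add_mult)
  fix l assume "l < length (fst (add_mult (sparse_cols_of A) (list_of_vec x) w))"
  then have l: "l < d" using w by (simp add: length_add_mult)
  have rows: "\<forall>es\<in>set (sparse_cols_of A). \<forall>e\<in>set es. fst e < length w"
    using A w by (auto simp: sparse_cols_of_def)
  have len: "length (sparse_cols_of A) = d" "length (list_of_vec x) = d"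
    using A x by (simp_all add: length_sparse_cols_of)
  have "fst (add_mult (sparse_cols_of A) (list_of_vec x) w) ! l =
      w ! l + (\<Sum>p\<leftarrow>zip (sparse_cols_of A) (list_of_vec x). \<Sum>e\<leftarrow>fst p. if fst e = l then snd e * snd p else 0)"
    using rows l w len by (intro nth_add_mult) simp_all
  also have "(\<Sum>p\<leftarrow>zip (sparse_cols_of A) (list_of_vec x). \<Sum>e\<leftarrow>fst p. if fst e = l then snd e * snd p else 0) =
      (\<Sum>j<d. \<Sum>e\<leftarrow>sparse_cols_of A ! j. if fst e = l then snd e * (x $ j) else 0)"
    using x len by (subst sum_list_sum_nth) (simp add: atLeast0LessThan list_of_vec_index cong: if_cong)
  also have "\<dots> = (\<Sum>j<d. A $$ (l, j) * x $ j)"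
    using A l by (intro sum.cong refl sum_sparse_col) auto
  also have "w ! l + \<dots> = list_of_vec (vec_of_list w + A *\<^sub>v x) ! l"
    using A x l w by (simp add: list_of_vec_index vec_of_list_index scalar_prod_def atLeast0LessThan)
  finally show "fst (add_mult (sparse_cols_of A) (list_of_vec x) w) ! l = list_of_vec (vec_of_list w + A *\<^sub>v x) ! l" .
qed

lemma length_sparse_col:
  assumes "A \<in> sparse_sign_mats d r" "es \<in> set (sparse_cols_of A)"
  shows "length es = r"
proof -
  have A: "A \<in> carrier_mat d d" by (rule sparse_sign_matsD[OF assms(1)])
  then obtain j where j: "j < d"
    "es = map (\<lambda>i. (i, A $$ (i, j))) (filter (\<lambda>i. A $$ (i, j) \<noteq> 0) [0..<d])"
    using assms(2) by (auto simp: sparse_cols_of_def)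
  have "length es = card (set (filter (\<lambda>i. A $$ (i, j) \<noteq> 0) [0..<d]))"
    unfolding j(2) length_map by (rule distinct_card[symmetric]) simp
  also have "set (filter (\<lambda>i. A $$ (i, j) \<noteq> 0) [0..<d]) = {i. i < d \<and> A $$ (i, j) \<noteq> 0}"
    by auto
  also have "card \<dots> = r" by (rule sparse_sign_matsD(3)[OF assms(1) j(1)])
  finally show ?thesis .
qed

lemma sum_list_sparse_cols:
  fixes f :: "nat \<Rightarrow> nat"
  assumes "A \<in> sparse_sign_mats d r"
  shows "(\<Sum>es\<leftarrow>sparse_cols_of A. f (length es)) = d * f r"
proof -
  have "(\<Sum>es\<leftarrow>sparse_cols_of A. f (length es)) = (\<Sum>es\<leftarrow>sparse_cols_of A. f r)"
    using length_sparse_col[OF assms] by (intro arg_cong[of _ _ sum_list] map_cong) auto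
  also have "\<dots> = d * f r"
    using sparse_sign_matsD(1)[OF assms] by (simp add: sum_list_triv length_sparse_cols_of)
  finally show ?thesis .
qed

definition sparse_pair :: "pair_map \<Rightarrow> sparse_cols \<times> sparse_cols" where
  "sparse_pair \<phi> = (sparse_cols_of (fst \<phi>), sparse_cols_of (snd \<phi>))"

text \<open>The first \<open>d\<close> initialises the accumulator. Each of the two matrices costs
  \<open>2 * r + 2\<close> per column and 1 for the end of its list; the last 1 is the call.\<close>

definition eval_time :: "nat \<Rightarrow> nat \<Rightarrow> nat" where
  "eval_time d r = d + 2 * (d * (2 * r + 2) + 1) + 1"

lemma eval_map_sparse_pair:
  assumes \<phi>: "\<phi> \<in> sparse_sign_mats d r \<times> sparse_sign_mats d r"
    and x: "x \<in> carrier_vec d" and y: "y \<in> carrier_vec d"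
  shows "eval_map d (sparse_pair \<phi>) (list_of_vec x) (list_of_vec y) =
    (list_of_vec (apply_map \<phi> x y), eval_time d r)"
proof -
  obtain A B where AB: "\<phi> = (A, B)" "A \<in> sparse_sign_mats d r" "B \<in> sparse_sign_mats d r"
    using \<phi> by auto
  have c: "A \<in> carrier_mat d d" "B \<in> carrier_mat d d"
    using AB sparse_sign_matsD(1) by auto
  have time: "snd (add_mult (sparse_cols_of C) (list_of_vec z) w) = d * (2 * r + 2) + 1"
    if "C \<in> sparse_sign_mats d r" "z \<in> carrier_vec d" for C z w
    using that sparse_sign_matsD(1)[OF that(1)] sum_list_sparse_cols[OF that(1), of "\<lambda>l. 2 * l + 2"]
    by (subst time_add_mult) (simp_all add: length_sparse_cols_of)
  have zero: "vec_of_list (replicate d 0) + A *\<^sub>v x = A *\<^sub>v x"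
    using c by (intro eq_vecI) (auto simp: vec_of_list_index)
  have fst0: "fst (add_mult (sparse_cols_of A) (list_of_vec x) (replicate d 0)) = list_of_vec (A *\<^sub>v x)"
    using add_mult_sparse_cols[OF c(1) x, of "replicate d 0"] zero by simp
  have fst1: "fst (add_mult (sparse_cols_of B) (list_of_vec y) (list_of_vec (A *\<^sub>v x))) =
      list_of_vec (A *\<^sub>v x + B *\<^sub>v y)"
    using add_mult_sparse_cols[OF c(2) y, of "list_of_vec (A *\<^sub>v x)"] c by (simp add: vec_list)
  show ?thesis
    using AB x y by (simp add: sparse_pair_def Let_def case_prod_beta fst0 fst1 time apply_map_def eval_time_def)
qed

section \<open>Exact results and step counts of the levels and of the whole run\<close>

text \<open>List positions start at 0, so siblings sit at \<open>2 * j\<close> and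
  \<open>2 * j + 1\<close>. The induction removes the first pair, shifting \<open>g\<close> by two
  and \<open>h\<close> by one.\<close>

lemma combine_pairs_map:
  assumes "\<And>j. j < N \<Longrightarrow> eval_map d B (g (2 * j)) (g (2 * j + 1)) = (h j, t)"
  shows "combine_pairs d B (map g [0..<2 * N]) = (map h [0..<N], N * (t + 1) + 1)"
  using assms
proof (induction N arbitrary: g h)
  case (Suc N)
  have IH: "combine_pairs d B (map (\<lambda>i. g (i + 2)) [0..<2 * N]) =
      (map (\<lambda>j. h (Suc j)) [0..<N], N * (t + 1) + 1)"
  proof (rule Suc.IH)
    fix j assume "j < N"
    then show "eval_map d B (g (2 * j + 2)) (g (2 * j + 1 + 2)) = (h (Suc j), t)"
      using Suc.prems[of "Suc j"] by (simp add: algebra_simps)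
  qed
  have g: "map g [0..<2 * Suc N] = g 0 # g 1 # map (\<lambda>i. g (i + 2)) [0..<2 * N]"
    by (rule nth_equalityI) (auto simp: nth_Cons split: nat.split simp del: upt_Suc)
  have h: "map h [0..<Suc N] = h 0 # map (\<lambda>j. h (Suc j)) [0..<N]"
    by (rule nth_equalityI) (auto simp: nth_Cons split: nat.split simp del: upt_Suc)
  have "eval_map d B (g 0) (g 1) = (h 0, t)" using Suc.prems[of 0] by simp
  then have "combine_pairs d B (map g [0..<2 * Suc N]) =
      (h 0 # map (\<lambda>j. h (Suc j)) [0..<N], t + (N * (t + 1) + 1) + 1)"
    unfolding g by (simp only: combine_pairs.simps IH Let_def prod.case)
  then show ?case unfolding h by simp
qed simp

text \<open>The start level \<open>i\<close> is arbitrary because the induction on the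
  \<open>n\<close> remaining levels peels off the lowest one. A binary tree with
  \<open>2 ^ n\<close> leaves has \<open>2 ^ n - 1\<close> inner nodes, each paying one evaluation
  and one call; every level adds 2 steps and the end of the list 1.\<close>

lemma run_levels_sketch:
  assumes "\<And>l. 1 \<le> l \<Longrightarrow> l \<le> i + n \<Longrightarrow> \<phi> l \<in> sparse_sign_mats d r \<times> sparse_sign_mats d r"
  shows "run_levels d (map (\<lambda>l. sparse_pair (\<phi> l)) [Suc i..<Suc (i + n)])
      (map (\<lambda>j. list_of_vec (sketch_node d \<phi> x i (Suc j))) [0..<2 ^ n]) =
    ([list_of_vec (sketch_node d \<phi> x (i + n) 1)], (2 ^ n - 1) * (eval_time d r + 1) + 2 * n + 1)"
  using assms
proof (induction n arbitrary: i)
  case (Suc n)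
  have carrier: "sketch_node d \<phi> x i j \<in> carrier_vec d" for j
  proof (rule sketch_node_carrier)
    fix l assume "1 \<le> l" "l \<le> i"
    then have "\<phi> l \<in> sparse_sign_mats d r \<times> sparse_sign_mats d r" by (intro Suc.prems) simp_all
    then show "\<phi> l \<in> carrier_mat d d \<times> carrier_mat d d"
      by (auto simp: mem_Times_iff sparse_sign_mats_def)
  qed
  have \<phi>: "\<phi> (Suc i) \<in> sparse_sign_mats d r \<times> sparse_sign_mats d r" by (intro Suc.prems) simp_all
  have "combine_pairs d (sparse_pair (\<phi> (Suc i)))
      (map (\<lambda>j. list_of_vec (sketch_node d \<phi> x i (Suc j))) [0..<2 * 2 ^ n]) =
    (map (\<lambda>j. list_of_vec (sketch_node d \<phi> x (Suc i) (Suc j))) [0..<2 ^ n], 2 ^ n * (eval_time d r + 1) + 1)"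
    by (rule combine_pairs_map) (simp add: eval_map_sparse_pair[OF \<phi> carrier carrier])
  then have combine: "combine_pairs d (sparse_pair (\<phi> (Suc i)))
      (map (\<lambda>j. list_of_vec (sketch_node d \<phi> x i (Suc j))) [0..<2 ^ Suc n]) =
    (map (\<lambda>j. list_of_vec (sketch_node d \<phi> x (Suc i) (Suc j))) [0..<2 ^ n], 2 ^ n * (eval_time d r + 1) + 1)"
    by simp
  have IH: "run_levels d (map (\<lambda>l. sparse_pair (\<phi> l)) [Suc (Suc i)..<Suc (Suc i + n)])
      (map (\<lambda>j. list_of_vec (sketch_node d \<phi> x (Suc i) (Suc j))) [0..<2 ^ n]) =
    ([list_of_vec (sketch_node d \<phi> x (Suc i + n) 1)], (2 ^ n - 1) * (eval_time d r + 1) + 2 * n + 1)"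
    using Suc.prems by (intro Suc.IH) simp
  have upt: "[Suc i..<Suc (i + Suc n)] = Suc i # [Suc (Suc i)..<Suc (Suc i + n)]"
    by (subst upt_conv_Cons) simp_all
  \<comment> \<open>Of the \<open>2 ^ Suc n - 1\<close> inner nodes, \<open>2 ^ n\<close> are
    produced on this level and the rest above it.\<close>
  have time: "2 ^ n * T + ((2 ^ n - 1) * T + 2 * n) = (2 ^ Suc n - 1) * T + 2 * n" for T :: nat
  proof -
    have "2 ^ Suc n - 1 = 2 ^ n + (2 ^ n - 1 :: nat)" by simp
    then show ?thesis by (simp only: distrib_right add.assoc)
  qed
  have "run_levels d (map (\<lambda>l. sparse_pair (\<phi> l)) [Suc i..<Suc (i + Suc n)])
      (map (\<lambda>j. list_of_vec (sketch_node d \<phi> x i (Suc j))) [0..<2 ^ Suc n]) =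
    ([list_of_vec (sketch_node d \<phi> x (Suc i + n) 1)],
      (2 ^ n * (eval_time d r + 1) + 1) + ((2 ^ n - 1) * (eval_time d r + 1) + 2 * n + 1) + 1)"
    unfolding upt list.map by (simp only: run_levels.simps combine IH Let_def prod.case)
  then show ?case using time[of "eval_time d r + 1"] by simp
qed simp

lemma split_blocks_eq:
  "split_blocks d s xs = (map (\<lambda>j. take d (drop (d * j) xs)) [0..<s], s * (d + 1) + 1)"
proof (induction s arbitrary: xs)
  case (Suc s)
  have "map (\<lambda>j. take d (drop (d * j) xs)) [0..<Suc s] =
      take d xs # map (\<lambda>j. take d (drop (d * j) (drop d xs))) [0..<s]"
    by (rule nth_equalityI) (auto simp: nth_Cons add.commute split: nat.split simp del: upt_Suc)
  then show ?case by (simp add: Suc.IH del: upt_Suc)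
qed simp

lemma draw_maps_eq:
  assumes "\<And>\<phi>. \<phi> \<in> set \<phi>s \<Longrightarrow> \<phi> \<in> sparse_sign_mats d r \<times> sparse_sign_mats d r"
  shows "draw_maps \<phi>s = (map sparse_pair \<phi>s, length \<phi>s * (2 * (d * (r + 1) + 1) + 1) + 1)"
  using assms
proof (induction \<phi>s)
  case (Cons \<phi> \<phi>s)
  obtain A B where AB: "\<phi> = (A, B)" by fastforce
  have "A \<in> sparse_sign_mats d r" "B \<in> sparse_sign_mats d r"
    using Cons.prems[of \<phi>] AB by auto
  then have "draw_cols A = (sparse_cols_of A, d * (r + 1) + 1)" "draw_cols B = (sparse_cols_of B, d * (r + 1) + 1)"
    using sum_list_sparse_cols[of _ d r "\<lambda>l. l + 1"] by (simp_all add: Let_def)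
  then show ?case
    using Cons by (simp add: AB sparse_pair_def del: draw_cols.simps)
qed simp

lemma take_drop_list_of_vec:
  assumes "x \<in> carrier_vec (d * 2 ^ k)" "j < 2 ^ k"
  shows "take d (drop (d * j) (list_of_vec x)) = list_of_vec (sketch_node d \<phi> x 0 (Suc j))"
proof -
  have "d * j + d \<le> d * 2 ^ k"
    using mult_le_mono2[of "Suc j" "2 ^ k" d] assms(2) by simp
  then show ?thesis
    using assms(1) less_imp_le[OF assms(2)] by (intro nth_equalityI) (auto simp: list_of_vec_index)
qed

text \<open>The time is the same for all draws because every column has exactly \<open>r\<close>
  nonzero entries. The summands belong to drawing, splitting, the levels and the outer call, in this
  order.\<close>

lemma single_sketch_run_eq:
  assumes x: "x \<in> carrier_vec (d * 2 ^ k)"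
    and \<phi>: "\<And>l. 1 \<le> l \<Longrightarrow> l \<le> k \<Longrightarrow> \<phi> l \<in> sparse_sign_mats d r \<times> sparse_sign_mats d r"
  shows "single_sketch_run d k \<phi> x = (single_sketch d k \<phi> x,
    (k * (2 * (d * (r + 1) + 1) + 1) + 1) + (2 ^ k * (d + 1) + 1) +
    ((2 ^ k - 1) * (eval_time d r + 1) + 2 * k + 1) + 1)"
proof -
  have "draw_maps (map \<phi> [1..<Suc k]) = (map sparse_pair (map \<phi> [1..<Suc k]),
      length (map \<phi> [1..<Suc k]) * (2 * (d * (r + 1) + 1) + 1) + 1)"
  proof (rule draw_maps_eq)
    fix \<psi> assume "\<psi> \<in> set (map \<phi> [1..<Suc k])"
    then obtain l where "1 \<le> l" "l \<le> k" "\<psi> = \<phi> l" by (auto simp del: upt_Suc)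
    then show "\<psi> \<in> sparse_sign_mats d r \<times> sparse_sign_mats d r" using \<phi> by simp
  qed
  then have draw: "draw_maps (map \<phi> [1..<Suc k]) =
      (map (\<lambda>l. sparse_pair (\<phi> l)) [Suc 0..<Suc k], k * (2 * (d * (r + 1) + 1) + 1) + 1)"
    by (simp add: comp_def del: upt_Suc)
  have blocks: "split_blocks d (2 ^ k) (list_of_vec x) =
      (map (\<lambda>j. list_of_vec (sketch_node d \<phi> x 0 (Suc j))) [0..<2 ^ k], 2 ^ k * (d + 1) + 1)"
    unfolding split_blocks_eq using take_drop_list_of_vec[OF x, of _ \<phi>] by (auto simp del: sketch_node.simps)
  show ?thesis
    unfolding single_sketch_run_def draw blocks
    using run_levels_sketch[of 0 k \<phi> d r x] \<phi>
    by (simp add: single_sketch_def vec_list del: sketch_node.simps upt_Suc)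
qed

text \<open>The \<open>2 ^ k\<close> evaluations of cost proportional to \<open>d * r\<close>
  dominate; the cost of drawing \<open>k\<close> pairs is absorbed through
  \<open>k \<le> 2 ^ k\<close>.\<close>

lemma single_sketch_run_time_le:
  assumes "x \<in> carrier_vec (d * 2 ^ k)" "1 \<le> r" "1 \<le> d"
    and "\<And>l. 1 \<le> l \<Longrightarrow> l \<le> k \<Longrightarrow> \<phi> l \<in> sparse_sign_mats d r \<times> sparse_sign_mats d r"
  shows "snd (single_sketch_run d k \<phi> x) \<le> 28 * (d * 2 ^ k) * r"
proof -
  define q where "q = d * (r + 1)"
  define p :: nat where "p = 2 ^ k"
  have q: "d * 2 \<le> q" "q \<le> 2 * (d * r)" "2 \<le> q"
  proof -
    show "d * 2 \<le> q" unfolding q_def using assms(2) by (intro mult_le_mono2) simp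
    then show "2 \<le> q" using assms(3) by linarith
    have "d * (r + 1) \<le> d * (2 * r)" using assms(2) by (intro mult_le_mono2) simp
    then show "q \<le> 2 * (d * r)" unfolding q_def by simp
  qed
  have p: "k \<le> p" "1 \<le> p" unfolding p_def using less_exp[of k] by auto
  have "eval_time d r + 1 = d + 4 * q + 4"
    by (simp add: eval_time_def q_def algebra_simps)
  then have "snd (single_sketch_run d k \<phi> x) =
      (k * (2 * q + 3) + 1) + (p * (d + 1) + 1) + ((p - 1) * (d + 4 * q + 4) + 2 * k + 1) + 1"
    by (simp only: single_sketch_run_eq[OF assms(1,4)] snd_conv q_def[symmetric] p_def) (simp add: algebra_simps)
  also have "\<dots> \<le> (p * (2 * q + 3) + p) + (p * (d + 1) + p) + (p * (d + 4 * q + 4) + 2 * p + p) + p"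
    using p by (intro add_mono mult_le_mono) auto
  also have "\<dots> = p * (6 * q + 2 * d + 14)"
    by (simp add: algebra_simps)
  \<comment> \<open>With \<open>2 * d \<le> q\<close> and \<open>14 \<le> 7 * q\<close> the bracket
    is at most \<open>14 * q\<close>, and \<open>q \<le> 2 * (d * r)\<close> gives 28.\<close>
  also have "\<dots> \<le> p * (28 * (d * r))"
    using q by (intro mult_le_mono2) linarith
  also have "\<dots> = 28 * (d * 2 ^ k) * r"
    by (simp add: p_def)
  finally show ?thesis .
qed

section \<open>Instantiation with sparse sign matrices and choice of the constants\<close>

lemma unbiased_sparse_jl:
  assumes "1 \<le> r" "r \<le> d"
  shows "unbiased_pair_map (sparse_jl d r) d"
proof
  show "finite (set_pmf (sparse_jl d r))"
    using finite_sparse_sign_mats by (simp add: set_pmf_sparse_jl[OF assms])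
  show "set_pmf (sparse_jl d r) \<subseteq> carrier_mat d d \<times> carrier_mat d d"
    by (auto simp: set_pmf_sparse_jl[OF assms] sparse_sign_mats_def)
qed (rule norm_sq_error_moments[OF assms])

text \<open>The constants hidden in the asymptotic hypotheses are fixed first, so that
  \<open>K\<close>, \<open>T\<close> and \<open>c'\<close> are uniform in all remaining parameters.
  The form \<open>real k * \<epsilon> \<le> 1\<close> keeps \<open>k = 0\<close> in scope, where
  \<open>1 / k\<close> would be 0.\<close>

theorem theorem8:
  fixes c_d C_d C_r c :: real
  assumes "c_d > 0" and "C_d > 0" and "C_r > 0" and "c > 0"
  shows "\<exists>K > 0. \<exists>T > 0. \<exists>c' > 0.
    \<forall>(n::nat) (\<epsilon>::real) (d::nat) (r::nat) (m::nat) (k::nat) (x :: real vec).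
      n \<ge> 2 \<longrightarrow> \<epsilon> > 0 \<longrightarrow>
      c_d * ln (real n) / \<epsilon>\<^sup>2 \<le> real d \<longrightarrow> real d \<le> C_d * ln (real n) / \<epsilon>\<^sup>2 \<longrightarrow>
      1 \<le> r \<longrightarrow> r \<le> d \<longrightarrow> real r \<le> C_r * (real d * \<epsilon>) \<longrightarrow>
      jl_guarantee (sparse_jl d r) d \<epsilon> (real n powr (- c)) \<longrightarrow>
      d dvd m \<longrightarrow> m div d = 2 ^ k \<longrightarrow> real k * \<epsilon> \<le> 1 \<longrightarrow>
      x \<in> carrier_vec m \<longrightarrow>
        measure_pmf.prob (independent_maps k (sparse_jl d r))
          {\<phi>. approx_within (K * (real k * \<epsilon>)) (l2_norm (single_sketch d k \<phi> x)) (l2_norm x)}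
          \<ge> 1 - real n powr (- c') \<and>
        (\<forall>\<phi> \<in> set_pmf (independent_maps k (sparse_jl d r)).
          fst (single_sketch_run d k \<phi> x) = single_sketch d k \<phi> x \<and>
          real (snd (single_sketch_run d k \<phi> x)) \<le> T * (real m * ln (real n) / \<epsilon>) \<and>
          linear_on_vecs m d (single_sketch d k \<phi>))"
proof -
  \<comment> \<open>Chosen so that the lower bound on \<open>d\<close> together with
    \<open>n \<ge> 2\<close> gives \<open>sqrt (2 / real d) \<le> M * \<epsilon>\<close>, the form
    that the concentration lemma expects.\<close>
  define M where "M = sqrt (2 / (c_d * ln 2))"
  have M: "0 < M" using assms(1) by (simp add: M_def)
  have main: "measure_pmf.prob (independent_maps k (sparse_jl d r))
        {\<phi>. approx_within ((3 * (1 + M) + M) * (real k * \<epsilon>)) (l2_norm (single_sketch d k \<phi> x)) (l2_norm x)}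
        \<ge> 1 - real n powr (- (c / 2)) \<and>
      (\<forall>\<phi> \<in> set_pmf (independent_maps k (sparse_jl d r)).
        fst (single_sketch_run d k \<phi> x) = single_sketch d k \<phi> x \<and>
        real (snd (single_sketch_run d k \<phi> x)) \<le> 28 * C_r * C_d * (real m * ln (real n) / \<epsilon>) \<and>
        linear_on_vecs m d (single_sketch d k \<phi>))"
    if n: "n \<ge> 2" and \<epsilon>: "\<epsilon> > 0"
      and d_lower: "c_d * ln (real n) / \<epsilon>\<^sup>2 \<le> real d" and d_upper: "real d \<le> C_d * ln (real n) / \<epsilon>\<^sup>2"
      and r: "1 \<le> r" "r \<le> d" and r_upper: "real r \<le> C_r * (real d * \<epsilon>)"
      and jl: "jl_guarantee (sparse_jl d r) d \<epsilon> (real n powr (- c))"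
      and m_div: "d dvd m" "m div d = 2 ^ k" and k: "real k * \<epsilon> \<le> 1" and x: "x \<in> carrier_vec m"
    for n d r m k :: nat and \<epsilon> :: real and x :: "real vec"
  proof -
    interpret unbiased_pair_map "sparse_jl d r" d by (rule unbiased_sparse_jl[OF r])
    have m: "m = d * 2 ^ k" using m_div by (metis dvd_mult_div_cancel)
    have d: "1 \<le> d" using r by simp
    have "sqrt (2 / real d) \<le> sqrt (2 / (c_d * ln 2) * \<epsilon>\<^sup>2)"
    proof (rule real_sqrt_le_mono)
      have "c_d * ln 2 \<le> c_d * ln (real n)" using n assms(1) by (intro mult_left_mono) auto
      also have "\<dots> \<le> real d * \<epsilon>\<^sup>2" using d_lower \<epsilon> by (simp add: pos_divide_le_eq)
      finally show "2 / real d \<le> 2 / (c_d * ln 2) * \<epsilon>\<^sup>2"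
        using d assms(1) by (simp add: field_simps)
    qed
    also have "\<dots> = M * \<epsilon>" unfolding M_def real_sqrt_mult using \<epsilon> by simp
    finally have sd: "sqrt (2 / real d) \<le> M * \<epsilon>" .
    \<comment> \<open>The root from Cauchy-Schwarz halves the exponent, whence
      \<open>c' = c / 2\<close>.\<close>
    have sqrt_n: "sqrt (real n powr (- c)) = real n powr (- (c / 2))"
      using n by (simp add: powr_half_sqrt[symmetric] powr_powr)
    have "measure_pmf.expectation (sparse_jl d r) (\<lambda>\<phi>. bad_error \<epsilon> \<phi> u v) \<le>
        M * \<epsilon> * real n powr (- (c / 2)) * ((l2_norm u)\<^sup>2 + (l2_norm v)\<^sup>2)"
      if "u \<in> carrier_vec d" "v \<in> carrier_vec d" for u v
    proof -
      have "measure_pmf.expectation (sparse_jl d r) (\<lambda>\<phi>. bad_error \<epsilon> \<phi> u v) \<le>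
          sqrt (2 / real d) * real n powr (- (c / 2)) * ((l2_norm u)\<^sup>2 + (l2_norm v)\<^sup>2)"
        using expectation_bad_error_le[OF r that jl] unfolding sqrt_n .
      also have "\<dots> \<le> M * \<epsilon> * real n powr (- (c / 2)) * ((l2_norm u)\<^sup>2 + (l2_norm v)\<^sup>2)"
        using sd by (intro mult_right_mono) auto
      finally show ?thesis .
    qed
    then have "measure_pmf.prob (independent_maps k (sparse_jl d r))
        {\<phi>. approx_within ((3 * (1 + M) + M) * (real k * \<epsilon>)) (l2_norm (single_sketch d k \<phi> x)) (l2_norm x)}
        \<ge> 1 - real n powr (- (c / 2))"
      using x \<epsilon> k M unfolding m by (intro single_sketch_concentration) auto
    moreover have "fst (single_sketch_run d k \<phi> x) = single_sketch d k \<phi> x \<and>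
        real (snd (single_sketch_run d k \<phi> x)) \<le> 28 * C_r * C_d * (real m * ln (real n) / \<epsilon>) \<and>
        linear_on_vecs m d (single_sketch d k \<phi>)"
      if \<phi>: "\<phi> \<in> set_pmf (independent_maps k (sparse_jl d r))" for \<phi>
    proof (intro conjI)
      have supp: "\<phi> l \<in> sparse_sign_mats d r \<times> sparse_sign_mats d r" if "1 \<le> l" "l \<le> k" for l
        using set_independent_maps[OF \<phi> that] by (simp only: set_pmf_sparse_jl[OF r])
      show "fst (single_sketch_run d k \<phi> x) = single_sketch d k \<phi> x"
        using x supp unfolding m by (subst single_sketch_run_eq) auto
      \<comment> \<open>One factor \<epsilon> cancels against the dimension, so \<open>r\<close> is
        of order \<open>ln (real n) / \<epsilon>\<close>, and the time bound
        \<open>28 * m * r\<close> takes the claimed form.\<close>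
      have "real d * \<epsilon> \<le> C_d * ln (real n) / \<epsilon>"
        using mult_right_mono[OF d_upper, of \<epsilon>] \<epsilon> by (simp add: power2_eq_square)
      then have "C_r * (real d * \<epsilon>) \<le> C_r * (C_d * ln (real n) / \<epsilon>)"
        using assms(3) by (intro mult_left_mono) auto
      then have r_le: "real r \<le> C_r * (C_d * ln (real n) / \<epsilon>)"
        using r_upper by linarith
      have "snd (single_sketch_run d k \<phi> x) \<le> 28 * m * r"
        using x supp unfolding m by (intro single_sketch_run_time_le r d)
      then have "real (snd (single_sketch_run d k \<phi> x)) \<le> 28 * real m * real r"
        using of_nat_mono by fastforce
      also have "\<dots> \<le> 28 * real m * (C_r * (C_d * ln (real n) / \<epsilon>))"
        using r_le by (intro mult_left_mono) auto
      also have "\<dots> = 28 * C_r * C_d * (real m * ln (real n) / \<epsilon>)"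
        by simp
      finally show "real (snd (single_sketch_run d k \<phi> x)) \<le> 28 * C_r * C_d * (real m * ln (real n) / \<epsilon>)" .
      show "linear_on_vecs m d (single_sketch d k \<phi>)"
        unfolding m by (intro linear_single_sketch independent_maps_carrier[OF \<phi>])
    qed
    ultimately show ?thesis by blast
  qed
  show ?thesis
  proof (intro exI conjI allI impI)
    show "0 < 3 * (1 + M) + M" "0 < 28 * C_r * C_d" "0 < c / 2"
      using M assms by auto
  qed (use main in blast)+
qed

end
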